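(* Let $k\ge 1$, $\varepsilon>0$, and let $\mathcal W$ be a family of channels with input alphabet $[2k]$. The sample complexity of $(2k,\varepsilon)$-distribution learning under local constraints $\mathcal W$ using sequentially interactive protocols is \[ \Omega\!\left(\frac{k^2}{\varepsilon^2\,\|\mathcal W\|_{\ast}}\right). \]
   Context: A channel $W\colon[2k]\to\mathcal Y$ ($\mathcal Y$ finite or countable) is a Markov kernel: $W(y\mid x)\ge 0$ and $\sum_y W(y\mid x)=1$ for each $x\in[2k]=\{1,\dots,2k\}$. A sequentially interactive protocol with $n$ users using $\mathcal W$ works as follows: $X_1,\dots,X_n$ are i.i.d. samples from an unknown distribution $p$ on $[2k]$; $U$ is a public random variable independent of $(X_1,\dots,X_n)$; user $t$ selects a channel $W_t\in\mathcal W$ as a function of $(Y_1,\dots,Y_{t-1},U)$ and outputs $Y_t$ drawn according to $W_t(\cdot\mid X_t)$. The transcript is $(Y^n,U)$. An $(n,\varepsilon)$-estimator using $\mathcal W$ is such a protocol together with a map $\hat p$ from transcripts to distributions on $[2k]$ such that $\sup_p \Pr[d_{TV}(\hat p(Y^n,U),p)>\varepsilon]\le 1/100$, where $d_{TV}(p_1,p_2)=\sup_{S\subseteq[2k]}(p_1(S)-p_2(S))$. The sample complexity of $(2k,\varepsilon)$-distribution learning is the least $n$ for which an $(n,\varepsilon)$-estimator exists. For a channel $W$, the $k\times k$ channel information matrix is \[ H(W)_{i_1,i_2}=\sum_{y\in\mathcal Y}\frac{(W(y\mid 2i_1-1)-W(y\mid 2i_1))(W(y\mid 2i_2-1)-W(y\mid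 2i_2))}{\sum_{x\in[2k]}W(y\mid x)},\quad i_1,i_2\in[k] \] (sum over $y$ with positive denominator), and $\|\mathcal W\|_\ast=\sup_{W\in\mathcal W}\|H(W)\|_\ast$ (nuclear norm). $f=\Omega(g)$ means $f\ge c\,g$ for an absolute constant $c>0$.
   Formalization: Proved for 0 < ε ≤ 1/4: for all ε > 0 the bound is false (for ε ≥ 1 any constant estimate works with n = 0, yet the bound is positive), and an absolute constant needs ε bounded away from 1/2. The public variable U takes real values, which loses nothing. *)

theory Defs
  imports
    "HOL-Probability.Probability"
    "Jordan_Normal_Form.Char_Poly"
begin

(* Input symbols are 1, ..., 2k; values of a channel at other arguments play no role.
   Every finite or countable output alphabet is identified with a subset of the naturals, so
   that families over all alphabets live in one type. *)

type_synonym channel = "nat \<Rightarrow> nat pmf"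

definition inputs :: "nat \<Rightarrow> nat set" where
  "inputs k = {1..2 * k}"

definition dists :: "nat \<Rightarrow> nat pmf set" where
  "dists k = {p. set_pmf p \<subseteq> inputs k}"

definition dTV :: "nat \<Rightarrow> nat pmf \<Rightarrow> nat pmf \<Rightarrow> real" where
  "dTV k p q = (SUP S\<in>Pow (inputs k). measure_pmf.prob p S - measure_pmf.prob q S)"

(* Matrix indices start at 0: the index i stands for the pair of input symbols 2i+1, 2i+2. *)

definition channel_information_matrix :: "nat \<Rightarrow> channel \<Rightarrow> real Matrix.mat" where
  "channel_information_matrix k W = Matrix.mat k k (\<lambda>(i, j).
     \<Sum>\<^sub>\<infinity>y\<in>{y. 0 < (\<Sum>x\<in>inputs k. pmf (W x) y)}.
       (pmf (W (2 * i + 1)) y - pmf (W (2 * i + 2)) y) *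
       (pmf (W (2 * j + 1)) y - pmf (W (2 * j + 2)) y) /
       (\<Sum>x\<in>inputs k. pmf (W x) y))"

(* Sum of the singular values: the square roots of the eigenvalues of A\<^sup>T A, counted with their
   multiplicities as roots of the characteristic polynomial (all of them real and nonnegative). *)

definition nuclear_norm :: "real Matrix.mat \<Rightarrow> real" where
  "nuclear_norm A =
     (let q = char_poly (transpose_mat A * A)
      in \<Sum>e | poly q e = 0. real (order e q) * sqrt e)"

definition family_norm :: "nat \<Rightarrow> channel set \<Rightarrow> ennreal" where
  "family_norm k \<W> = (SUP W\<in>\<W>. ennreal (nuclear_norm (channel_information_matrix k W)))"

(* The channel chosen by a user, given the earlier messages (oldest first) and the value of the
   public randomness U. U takes values in an arbitrary probability space carried by a set of
   reals, not necessarily with the Borel sigma-algebra. *)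

type_synonym selection = "nat list \<Rightarrow> real \<Rightarrow> channel"

definition protocol :: "nat \<Rightarrow> nat \<Rightarrow> channel set \<Rightarrow> real measure \<Rightarrow> selection \<Rightarrow> bool" where
  "protocol k n \<W> M sel \<longleftrightarrow> prob_space M \<and>
     (\<forall>ys u. length ys < n \<longrightarrow> u \<in> space M \<longrightarrow> sel ys u \<in> \<W>) \<and>
     (\<forall>ys x y. length ys < n \<longrightarrow> x \<in> inputs k \<longrightarrow>
        (\<lambda>u. pmf (sel ys u x) y) \<in> borel_measurable M)"

primrec messages_from :: "selection \<Rightarrow> real \<Rightarrow> nat list \<Rightarrow> nat list \<Rightarrow> nat list pmf" where
  "messages_from sel u [] ys = return_pmf ys"
| "messages_from sel u (x # xs) ys = bind_pmf (sel ys u x) (\<lambda>y. messages_from sel u xs (ys @ [y]))"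

(* Conditional law of the n messages given U = u, for i.i.d. samples from p independent of U. *)

definition messages :: "nat \<Rightarrow> selection \<Rightarrow> nat pmf \<Rightarrow> real \<Rightarrow> nat list pmf" where
  "messages n sel p u = bind_pmf (replicate_pmf n p) (\<lambda>xs. messages_from sel u xs [])"

definition failure_prob ::
  "nat \<Rightarrow> nat \<Rightarrow> real \<Rightarrow> real measure \<Rightarrow> selection \<Rightarrow> (nat list \<Rightarrow> real \<Rightarrow> nat pmf) \<Rightarrow> nat pmf \<Rightarrow> ennreal"
where
  "failure_prob k n \<epsilon> M sel phat p =
     (\<integral>\<^sup>+ u. emeasure (measure_pmf (messages n sel p u)) {ys. dTV k (phat ys u) p > \<epsilon>} \<partial>M)"

definition estimator ::
  "nat \<Rightarrow> nat \<Rightarrow> real \<Rightarrow> channel set \<Rightarrow> real measure \<Rightarrow> selection \<Rightarrow> (nat list \<Rightarrow> real \<Rightarrow> nat pmf) \<Rightarrow> bool"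
where
  "estimator k n \<epsilon> \<W> M sel phat \<longleftrightarrow> protocol k n \<W> M sel \<and>
     (\<forall>ys u. length ys = n \<longrightarrow> u \<in> space M \<longrightarrow> phat ys u \<in> dists k) \<and>
     (\<forall>ys x. length ys = n \<longrightarrow> x \<in> inputs k \<longrightarrow> (\<lambda>u. pmf (phat ys u) x) \<in> borel_measurable M) \<and>
     (SUP p\<in>dists k. failure_prob k n \<epsilon> M sel phat p) \<le> ennreal (1 / 100)"

(* Infinite if there is no estimator for any n. For k = 1 it is 0 as soon as \<epsilon> \<ge> 1/2, since the
   uniform distribution is then within \<epsilon> of every p; lower bounds need \<epsilon> bounded away from 1/2. *)

definition sample_complexity :: "nat \<Rightarrow> real \<Rightarrow> channel set \<Rightarrow> enat" where
  "sample_complexity k \<epsilon> \<W> = (INF n\<in>{n. \<exists>M sel phat. estimator k n \<epsilon> \<W> M sel phat}. enat n)"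

end

theory Submission
  imports Defs "Jordan_Normal_Form.Schur_Decomposition"
begin

text \<open>
  For \<open>z \<subseteq> {0..<k}\<close> let \<open>p\<^sub>z\<close> be the uniform distribution in which the mass of the \<open>i\<close>-th pair of symbols
  is tilted by \<open>\<plusminus>\<gamma>\<close>, \<open>\<gamma> = 3\<epsilon>\<close>, according to whether \<open>i \<in> z\<close>. An estimate within \<open>\<epsilon>\<close> of \<open>p\<^sub>z\<close> yields
  numbers \<open>d\<^sub>i \<in> [-1, 1]\<close> with \<open>\<Sum>\<^sub>i z\<^sub>i d\<^sub>i \<ge> k/3\<close>. On the other hand, averaged over \<open>z\<close>, the correlation of
  \<open>d\<^sub>i\<close> with \<open>z\<^sub>i\<close> is controlled by the distance of the transcript laws \<open>P, Q\<close> under \<open>p\<^sub>z\<close> and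
  under \<open>p\<^sub>z\<close> with \<open>i\<close> flipped. We measure it by the triangular discrimination \<open>\<Sum> (P - Q)\<^sup>2 / (P + Q)\<close>,
  the mean square of the posterior mean of a uniform sign. As that posterior mean is a martingale,
  the discrimination grows additively along the transcript even under adaptive channel choices, and
  each message contributes at most \<open>O(\<gamma>\<^sup>2/k)\<close> times a diagonal entry of the information matrix of
  the channel used. Summing over \<open>i\<close> gives the trace, which is at most the nuclear norm.
\<close>

subsection \<open>Trace and nuclear norm of symmetric matrices\<close>

lemma order_prod_list_linear:
  fixes as :: "'a::idom list"
  shows "Polynomial.order x (\<Prod>a\<leftarrow>as. [:- a, 1:]) = count_list as x"
proof (induction as)
  case (Cons a as)
  have "(\<Prod>a\<leftarrow>as. [:- a, 1:]) \<noteq> 0"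
    by (auto simp: prod_list_zero_iff)
  then have "[:- a, 1:] * (\<Prod>a\<leftarrow>as. [:- a, 1:]) \<noteq> 0"
    unfolding mult_eq_0_iff by simp
  from order_mult[OF this] Cons show ?case
    by (auto simp: order_linear')
qed simp

lemma sum_count_list_real:
  fixes f :: "'a \<Rightarrow> real"
  shows "(\<Sum>x\<in>set as. real (count_list as x) * f x) = sum_list (map f as)"
proof (induction as)
  case (Cons a as)
  have "(\<Sum>x\<in>set (a # as). real (count_list (a # as) x) * f x) =
      (\<Sum>x\<in>set (a # as). (if x = a then f a else 0) + real (count_list as x) * f x)"
    by (intro sum.cong refl) (auto simp: algebra_simps)
  also have "\<dots> = f a + (\<Sum>x\<in>set (a # as). real (count_list as x) * f x)"
    by (simp add: sum.distrib)
  also have "(\<Sum>x\<in>set (a # as). real (count_list as x) * f x) =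
      (\<Sum>x\<in>set as. real (count_list as x) * f x)"
    by (rule sum.mono_neutral_right) auto
  finally show ?case using Cons by simp
qed simp

text \<open>Turns the sum in \<open>nuclear_norm\<close>, over distinct roots weighted by
  multiplicity, into a sum over the list of linear factors once the polynomial splits.\<close>

lemma sum_roots_prod_list_linear:
  fixes as :: "real list" and f :: "real \<Rightarrow> real"
  defines "q \<equiv> (\<Prod>a\<leftarrow>as. [:- a, 1:])"
  shows "(\<Sum>e | poly q e = 0. real (Polynomial.order e q) * f e) = sum_list (map f as)"
proof -
  have "{e. poly q e = 0} = set as"
    unfolding q_def by (auto simp: poly_prod_list prod_list_zero_iff)
  then show ?thesis
    unfolding q_def order_prod_list_linear by (simp add: sum_count_list_real)
qed

text \<open>The Hermitian form \<open>S\<close> of an eigenvector v is its own conjugate because A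
  is real and symmetric. It also equals e |v|^2 with v nonzero, which forces
  \<open>cnj e = e\<close>.\<close>

lemma eigenvalue_symmetric_real:
  fixes A :: "real mat"
  assumes A: "A \<in> carrier_mat n n" and sym: "transpose_mat A = A"
    and ev: "eigenvalue (map_mat complex_of_real A) e"
  shows "e \<in> \<real>"
proof -
  from ev A obtain v where v: "v \<in> carrier_vec n" "v \<noteq> 0\<^sub>v n"
    and Av: "map_mat complex_of_real A *\<^sub>v v = e \<cdot>\<^sub>v v"
    by (auto simp: eigenvalue_def eigenvector_def)
  have Aji: "A $$ (j, i) = A $$ (i, j)" if "i < n" "j < n" for i j
    using that A sym by (metis carrier_matD index_transpose_mat(1))
  define S where "S = (\<Sum>i<n. \<Sum>j<n. cnj (v $ i) * of_real (A $$ (i, j)) * v $ j)"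
  define N where "N = (\<Sum>i<n. (cmod (v $ i))\<^sup>2)"
  have row: "(\<Sum>j<n. of_real (A $$ (i, j)) * v $ j) = e * v $ i" if "i < n" for i
  proof -
    have "(map_mat complex_of_real A *\<^sub>v v) $ i = (\<Sum>j<n. of_real (A $$ (i, j)) * v $ j)"
      using that A v by (auto simp: scalar_prod_def lessThan_atLeast0 intro!: sum.cong)
    then show ?thesis using Av that v by simp
  qed
  have "S = (\<Sum>i<n. cnj (v $ i) * (e * v $ i))"
    unfolding S_def by (intro sum.cong refl) (simp add: row[symmetric] sum_distrib_left mult.assoc)
  also have "\<dots> = e * of_real N"
    unfolding N_def of_real_sum sum_distrib_left
    by (intro sum.cong refl) (simp only: complex_norm_square mult_ac)
  finally have S: "S = e * of_real N" .
  have "cnj S = (\<Sum>i<n. \<Sum>j<n. v $ i * of_real (A $$ (i, j)) * cnj (v $ j))"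
    by (simp add: S_def)
  also have "\<dots> = (\<Sum>j<n. \<Sum>i<n. v $ i * of_real (A $$ (i, j)) * cnj (v $ j))"
    by (rule sum.swap)
  also have "\<dots> = S"
    unfolding S_def by (intro sum.cong refl) (simp add: Aji mult_ac)
  finally have "cnj e * of_real N = e * of_real N"
    by (simp add: S)
  moreover have "N \<noteq> 0"
  proof
    assume "N = 0"
    then have "\<forall>i<n. v $ i = 0"
      unfolding N_def by (subst (asm) sum_nonneg_eq_0_iff) auto
    then have "v = 0\<^sub>v n" using v by auto
    with v show False by simp
  qed
  ultimately show ?thesis by (simp add: Reals_cnj_iff)
qed

text \<open>The complex factorisation has only real roots, so it descends along the injective
  embedding of real polynomials.\<close>

lemma char_poly_symmetric_splits:
  fixes A :: "real mat"
  assumes A: "A \<in> carrier_mat n n" and sym: "transpose_mat A = A"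
  obtains es where "char_poly A = (\<Prod>e\<leftarrow>es. [:- e, 1:])"
proof -
  let ?C = "map_mat complex_of_real A"
  have C: "?C \<in> carrier_mat n n" using A by simp
  obtain as where as: "char_poly ?C = (\<Prod>a\<leftarrow>as. [:- a, 1:])"
    using char_poly_factorized[OF C] by blast
  have real: "a \<in> \<real>" if "a \<in> set as" for a
  proof (rule eigenvalue_symmetric_real[OF A sym])
    show "eigenvalue ?C a"
      unfolding eigenvalue_root_char_poly[OF C] as
      using that by (auto simp: poly_prod_list prod_list_zero_iff)
  qed
  interpret mp: map_poly_inj_comm_ring_hom complex_of_real ..
  have "map_poly complex_of_real (\<Prod>e\<leftarrow>map Re as. [:- e, 1:]) = (\<Prod>a\<leftarrow>as. [:- a, 1:])"
    using real
  proof (induction as)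
    case (Cons a as)
    then have "complex_of_real (Re a) = a" by simp
    moreover have "map_poly complex_of_real (\<Prod>e\<leftarrow>map Re as. [:- e, 1:]) = (\<Prod>a\<leftarrow>as. [:- a, 1:])"
      using Cons by simp
    ultimately show ?case
      unfolding list.map prod_list.Cons mp.hom_mult by simp
  qed simp
  also have "\<dots> = map_poly complex_of_real (char_poly A)"
    using as of_real_hom.char_poly_hom[OF A, where ?'a = complex] by simp
  finally have "char_poly A = (\<Prod>e\<leftarrow>map Re as. [:- e, 1:])"
    unfolding mp.eq_iff by simp
  with that show ?thesis .
qed

lemma trace_mult_commute:
  fixes A B :: "'a::comm_semiring_0 mat"
  assumes "A \<in> carrier_mat n n" "B \<in> carrier_mat n n"
  shows "(\<Sum>i<n. (A * B) $$ (i, i)) = (\<Sum>i<n. (B * A) $$ (i, i))"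
proof -
  have "(\<Sum>i<n. (A * B) $$ (i, i)) = (\<Sum>i<n. \<Sum>j<n. A $$ (i, j) * B $$ (j, i))"
    using assms by (auto simp: scalar_prod_def lessThan_atLeast0)
  also have "\<dots> = (\<Sum>j<n. \<Sum>i<n. A $$ (i, j) * B $$ (j, i))"
    by (rule sum.swap)
  also have "\<dots> = (\<Sum>i<n. (B * A) $$ (i, i))"
    using assms by (auto simp: scalar_prod_def lessThan_atLeast0 mult.commute)
  finally show ?thesis .
qed

text \<open>Real eigenvalues allow a triangularisation A = P B Q over the reals, with P and Q
  mutually inverse. Then A^T A = A A is similar to B B, so the singular values are the absolute
  values of the diagonal entries of B, while the trace sums the entries themselves.\<close>

lemma trace_le_nuclear_norm:
  fixes A :: "real mat"
  assumes A: "A \<in> carrier_mat n n" and sym: "transpose_mat A = A"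
  shows "(\<Sum>i<n. A $$ (i, i)) \<le> nuclear_norm A"
proof -
  obtain es where es: "char_poly A = (\<Prod>e\<leftarrow>es. [:- e, 1:])"
    using char_poly_symmetric_splits[OF A sym] .
  obtain B P Q where "schur_decomposition A es = (B, P, Q)"
    by (cases "schur_decomposition A es") auto
  from schur_decomposition[OF A es this]
  have wit: "similar_mat_wit A B P Q" and ut: "upper_triangular B"
    by auto
  note wD = similar_mat_witD2[OF A wit]
  have "similar_mat_wit (A * A) (B * B) P Q"
    using similar_mat_wit_pow[OF wit, of 2] wD(4,5) by (simp add: numeral_2_eq_2)
  then have cp: "char_poly (A * A) = char_poly (B * B)"
    by (intro char_poly_similar) (auto simp: similar_mat_def)
  have utB: "B $$ (i, j) = 0" if "j < i" "i < n" for i j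
    using ut that wD(5) by auto
  have dg: "(B * B) $$ (i, i) = (B $$ (i, i))\<^sup>2" if "i < n" for i
  proof -
    have "(B * B) $$ (i, i) = (\<Sum>j<n. B $$ (i, j) * B $$ (j, i))"
      using that wD(5) by (auto simp: scalar_prod_def lessThan_atLeast0)
    also have "\<dots> = (\<Sum>j<n. if j = i then (B $$ (i, i))\<^sup>2 else 0)"
      using that utB by (intro sum.cong refl) (metis lessThan_iff linorder_neq_iff mult_eq_0_iff power2_eq_square)
    finally show ?thesis using that by simp
  qed
  have "upper_triangular (B * B)"
  proof
    fix i j assume "j < i" "i < dim_row (B * B)"
    then have ij: "j < i" "i < n" using wD(5) by auto
    have "(B * B) $$ (i, j) = (\<Sum>l<n. B $$ (i, l) * B $$ (l, j))"
      using ij wD(5) by (auto simp: scalar_prod_def lessThan_atLeast0)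
    also have "\<dots> = 0"
      using ij utB by (intro sum.neutral) (metis lessThan_iff linorder_less_linear mult_eq_0_iff order.strict_trans)
    finally show "(B * B) $$ (i, j) = 0" .
  qed
  then have "char_poly (A * A) = (\<Prod>a\<leftarrow>diag_mat (B * B). [:- a, 1:])"
    unfolding cp using char_poly_upper_triangular[of "B * B" n] wD(5) by auto
  also have "diag_mat (B * B) = map (\<lambda>i. (B $$ (i, i))\<^sup>2) [0..<n]"
    using wD(5) dg by (auto simp: diag_mat_def)
  finally have "nuclear_norm A = sum_list (map sqrt (map (\<lambda>i. (B $$ (i, i))\<^sup>2) [0..<n]))"
    unfolding nuclear_norm_def Let_def sym by (simp only: sum_roots_prod_list_linear)
  also have "\<dots> = (\<Sum>i<n. \<bar>B $$ (i, i)\<bar>)"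
    by (simp add: comp_def interv_sum_list_conv_sum_set_nat lessThan_atLeast0)
  finally have nn: "nuclear_norm A = (\<Sum>i<n. \<bar>B $$ (i, i)\<bar>)" .
  have "(\<Sum>i<n. A $$ (i, i)) = (\<Sum>i<n. ((P * B) * Q) $$ (i, i))"
    using wD(3) by simp
  also have "\<dots> = (\<Sum>i<n. (Q * (P * B)) $$ (i, i))"
    using wD by (intro trace_mult_commute) auto
  also have "Q * (P * B) = B"
    using wD by (metis assoc_mult_mat left_mult_one_mat)
  also have "(\<Sum>i<n. B $$ (i, i)) \<le> (\<Sum>i<n. \<bar>B $$ (i, i)\<bar>)"
    by (intro sum_mono) simp
  finally show ?thesis by (simp add: nn)
qed

subsection \<open>Triangular discrimination\<close>

text \<open>The summand of the triangular (Vincze-Le Cam) discrimination. At a = b = 0 division by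
  zero gives 0, so outcomes impossible under both laws contribute nothing.\<close>

definition tri :: "real \<Rightarrow> real \<Rightarrow> real" where
  "tri a b = (a - b)\<^sup>2 / (a + b)"

lemma tri_nonneg: "0 \<le> a \<Longrightarrow> 0 \<le> b \<Longrightarrow> 0 \<le> tri a b"
  by (simp add: tri_def)

lemma tri_le_add: "0 \<le> a \<Longrightarrow> 0 \<le> b \<Longrightarrow> tri a b \<le> a + b"
proof -
  assume "0 \<le> a" "0 \<le> b"
  then have "(a - b)\<^sup>2 \<le> (a + b)\<^sup>2"
    by (simp add: power2_eq_square algebra_simps)
  then show ?thesis
    using \<open>0 \<le> a\<close> \<open>0 \<le> b\<close> by (cases "a + b = 0") (auto simp: tri_def divide_le_eq power2_eq_square)
qed

text \<open>|a - b| is the geometric mean of a + b and \<open>tri a b\<close>. AM-GM with a free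
  weight \<tau> replaces Cauchy-Schwarz by a bound that can be summed over outcomes.\<close>

lemma abs_diff_le_tri:
  assumes "0 \<le> a" "0 \<le> b" "0 < \<tau>"
  shows "\<bar>a - b\<bar> \<le> \<tau> * (a + b) + tri a b / (4 * \<tau>)"
proof (cases "a + b = 0")
  case True
  then have "a = 0" "b = 0" using assms by auto
  then show ?thesis by (simp add: tri_def)
next
  case False
  then have s: "a + b > 0" using assms by auto
  have "0 \<le> (2 * \<tau> * (a + b) - \<bar>a - b\<bar>)\<^sup>2" by simp
  then have "4 * \<tau> * (a + b) * \<bar>a - b\<bar> \<le> 4 * \<tau>\<^sup>2 * (a + b)\<^sup>2 + (a - b)\<^sup>2"
    by (simp add: power2_diff power_mult_distrib)
  then have "\<bar>a - b\<bar> \<le> (4 * \<tau>\<^sup>2 * (a + b)\<^sup>2 + (a - b)\<^sup>2) / (4 * \<tau> * (a + b))"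
    using s assms by (simp add: pos_le_divide_eq mult_ac)
  also have "\<dots> = \<tau> * (a + b) + tri a b / (4 * \<tau>)"
    unfolding tri_def using s assms(3)
    by (simp add: add_divide_distrib power2_eq_square)
  finally show ?thesis .
qed

text \<open>Pointwise form of one step: a, b are the weights of the past under two laws, p, q the
  probabilities of the next message. Up to the last term, the price of that message, the right side
  is linear in p and q, and over all messages it sums to \<open>tri a b\<close>.\<close>

lemma tri_mult_le:
  assumes "0 \<le> a" "0 \<le> b" "0 < a + b" "0 \<le> p" "0 \<le> q"
    and gp: "(p - q)\<^sup>2 \<le> g * p" and gq: "(p - q)\<^sup>2 \<le> g * q" and "0 \<le> g"
  shows "tri (a * p) (b * q) \<le>
    a * p + b * q - 4 * a * b / (a + b)\<^sup>2 * (a * q + b * p) + (a + b) / 4 * g"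
proof (cases "a * p + b * q = 0")
  case True
  then have "a * p = 0" "b * q = 0" using assms by (auto simp: add_nonneg_eq_0_iff)
  then have "a * b * (a * q + b * p) = 0" by (auto simp: algebra_simps)
  then have "4 * a * b / (a + b)\<^sup>2 * (a * q + b * p) = 0" by auto
  moreover have "0 \<le> (a + b) / 4 * g" using assms by simp
  moreover have "tri (a * p) (b * q) = 0" unfolding tri_def using True by simp
  ultimately show ?thesis using True by linarith
next
  case False
  define s m where "s = a + b" and "m = a * p + b * q"
  have s: "0 < s" and m: "0 < m" using False assms by (auto simp: s_def m_def add_nonneg_eq_0_iff less_le)
  have "a * (p - q)\<^sup>2 + b * (p - q)\<^sup>2 \<le> a * (g * p) + b * (g * q)"
    using assms by (intro add_mono mult_left_mono)
  then have 1: "s * (p - q)\<^sup>2 \<le> g * m"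
    by (simp add: s_def m_def algebra_simps)
  have 2: "4 * (a * b) \<le> s\<^sup>2"
    using zero_le_power2[of "a - b"] by (simp add: s_def power2_eq_square algebra_simps)
  have "(4 * (a * b))\<^sup>2 \<le> (s\<^sup>2)\<^sup>2"
    using 2 assms by (intro power_mono) auto
  then have "(4 * (a * b))\<^sup>2 * (s * (p - q)\<^sup>2) \<le> (s\<^sup>2)\<^sup>2 * (g * m)"
    by (rule mult_mono) (use 1 s in auto)
  then have 3: "4 * a\<^sup>2 * b\<^sup>2 * (p - q)\<^sup>2 / (s\<^sup>2 * m) \<le> s / 4 * g"
  proof -
    assume "(4 * (a * b))\<^sup>2 * (s * (p - q)\<^sup>2) \<le> (s\<^sup>2)\<^sup>2 * (g * m)"
    then have "s * (16 * a\<^sup>2 * b\<^sup>2 * (p - q)\<^sup>2) \<le> s * (s ^ 3 * g * m)"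
      by (simp add: power_mult_distrib power2_eq_square power3_eq_cube mult_ac)
    then have "16 * a\<^sup>2 * b\<^sup>2 * (p - q)\<^sup>2 \<le> s ^ 3 * g * m"
      using s by simp
    then have "4 * a\<^sup>2 * b\<^sup>2 * (p - q)\<^sup>2 \<le> s / 4 * g * (s\<^sup>2 * m)"
      by (simp add: power2_eq_square power3_eq_cube mult_ac)
    then show ?thesis
      using s m by (subst pos_divide_le_eq) auto
  qed
  have "tri (a * p) (b * q) = m - 4 * a * b * (p * q) / m"
    using m by (simp add: tri_def m_def field_simps power2_eq_square)
  \<comment> \<open>The identity p q s^2 = (a q + b p) m - a b (p - q)^2 trades the quotient for a
    linear part and an error. The error was bounded above by combining 4 a b \<le> s^2 with s (p -
    q)^2 \<le> g m.\<close>
  also have "p * q / m = (a * q + b * p) / s\<^sup>2 - a * b * (p - q)\<^sup>2 / (s\<^sup>2 * m)"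
  proof -
    have "p * q * s\<^sup>2 = (a * q + b * p) * m - a * b * (p - q)\<^sup>2"
      by (simp add: s_def m_def power2_eq_square algebra_simps)
    moreover have "p * q / m = p * q * s\<^sup>2 / (s\<^sup>2 * m)"
      using s by simp
    ultimately show ?thesis using m by (simp add: diff_divide_distrib)
  qed
  then have "m - 4 * a * b * (p * q) / m =
      m - 4 * a * b * (a * q + b * p) / s\<^sup>2 + 4 * a\<^sup>2 * b\<^sup>2 * (p - q)\<^sup>2 / (s\<^sup>2 * m)"
    by (simp only: times_divide_eq_right[symmetric]) (simp add: algebra_simps power2_eq_square)
  also have "\<dots> \<le> m - 4 * a * b * (a * q + b * p) / s\<^sup>2 + s / 4 * g"
    using 3 by simp
  finally show ?thesis by (simp add: s_def m_def)
qed

lemma has_sum_pmf: "(pmf p has_sum 1) UNIV"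
proof -
  have "pmf p summable_on UNIV"
    using pmf_abs_summable[of p UNIV] abs_summable_equivalent abs_summable_summable by blast
  moreover have "infsum (pmf p) UNIV = 1"
    using infsetsum_infsum[OF pmf_abs_summable[of p UNIV]] infsetsum_pmf_eq_1[of p UNIV] by simp
  ultimately show ?thesis by (metis has_sum_infsum)
qed

lemma nn_integral_count_space_has_sum:
  fixes f :: "'a \<Rightarrow> real"
  assumes "\<And>x. 0 \<le> f x" "(f has_sum s) UNIV"
  shows "(\<integral>\<^sup>+x. ennreal (f x) \<partial>count_space UNIV) = ennreal s"
proof -
  have "(\<lambda>x. norm (f x)) summable_on UNIV"
    using assms summable_on_def by auto
  then have i: "Infinite_Set_Sum.abs_summable_on f UNIV"
    using abs_summable_equivalent by blast
  have "infsetsum f UNIV = s"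
    using infsetsum_infsum[OF i] assms(2) infsumI by force
  with i assms(1) show ?thesis
    unfolding abs_summable_on_def infsetsum_def by (subst nn_integral_eq_integral) auto
qed

text \<open>Both a p + b q and a q + b p sum to a + b, so the linear part of
  \<open>tri_mult_le\<close> sums to (a + b) - 4 a b / (a + b) = \<open>tri a b\<close>. This
  reflects the orthogonality of martingale increments.\<close>

lemma nn_integral_tri_mult_pmf_le:
  fixes p q :: "'a pmf"
  assumes ab: "0 \<le> a" "0 \<le> b"
    and g: "\<And>y. 0 \<le> g y" "(g has_sum G) UNIV"
    and gp: "\<And>y. (pmf p y - pmf q y)\<^sup>2 \<le> g y * pmf p y"
    and gq: "\<And>y. (pmf p y - pmf q y)\<^sup>2 \<le> g y * pmf q y"
  shows "(\<integral>\<^sup>+y. ennreal (tri (a * pmf p y) (b * pmf q y)) \<partial>count_space UNIV)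
    \<le> ennreal (tri a b + (a + b) / 4 * G)"
proof (cases "a + b = 0")
  case True
  with ab have "a = 0" "b = 0" by auto
  then show ?thesis by (simp add: tri_def)
next
  case False
  with ab have s: "0 < a + b" by auto
  define r where "r y = a * pmf p y + b * pmf q y
    + (- (4 * a * b / (a + b)\<^sup>2)) * (a * pmf q y + b * pmf p y) + (a + b) / 4 * g y" for y
  have le: "tri (a * pmf p y) (b * pmf q y) \<le> r y" for y
    using tri_mult_le[OF ab s, of "pmf p y" "pmf q y" "g y"] g gp gq by (simp add: r_def)
  have "0 \<le> r y" for y
    using le[of y] tri_nonneg[of "a * pmf p y" "b * pmf q y"] ab by simp
  have "(r has_sum (a * 1 + b * 1 + (- (4 * a * b / (a + b)\<^sup>2)) * (a * 1 + b * 1) + (a + b) / 4 * G)) UNIV"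
    unfolding r_def
    using has_sum_pmf[of p] has_sum_pmf[of q] g(2)
    by (intro has_sum_add has_sum_cmult_right)
  also have "a * 1 + b * 1 + (- (4 * a * b / (a + b)\<^sup>2)) * (a * 1 + b * 1) = tri a b"
  proof -
    have "(a - b)\<^sup>2 = (a + b)\<^sup>2 - 4 * a * b"
      by (simp add: power2_eq_square algebra_simps)
    moreover have "t + (- (c / t\<^sup>2)) * t = (t\<^sup>2 - c) / t" if "0 < t" for t c :: real
      using that by (simp add: field_simps power2_eq_square)
    ultimately show ?thesis
      using s by (simp only: tri_def mult_1_right)
  qed
  finally have "(\<integral>\<^sup>+y. ennreal (r y) \<partial>count_space UNIV) = ennreal (tri a b + (a + b) / 4 * G)"
    using \<open>\<And>y. 0 \<le> r y\<close> by (intro nn_integral_count_space_has_sum)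
  then show ?thesis
    using le by (metis (no_types, lifting) ennreal_leI nn_integral_mono)
qed

subsection \<open>Perturbed distributions and the information matrix\<close>

lemma sum_inputs: "(\<Sum>x\<in>inputs k. f x) = (\<Sum>i<k. f (2 * i + 1) + f (2 * i + 2) :: 'a::comm_monoid_add)"
proof (induction k)
  case (Suc k)
  have "inputs (Suc k) = insert (2 * k + 2) (insert (2 * k + 1) (inputs k))"
    unfolding inputs_def by auto
  moreover have "2 * k + 2 \<notin> insert (2 * k + 1) (inputs k)" "2 * k + 1 \<notin> inputs k"
    "finite (inputs k)"
    by (auto simp: inputs_def)
  ultimately show ?case using Suc by (simp add: ac_simps)
qed (simp add: inputs_def)

text \<open>The summand at y of the i-th diagonal entry of the information matrix, extended by 0
  (division by zero) to y with vanishing denominator.\<close>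

definition info_density :: "nat \<Rightarrow> channel \<Rightarrow> nat \<Rightarrow> nat \<Rightarrow> real" where
  "info_density k W i y =
    (pmf (W (2 * i + 1)) y - pmf (W (2 * i + 2)) y)\<^sup>2 / (\<Sum>x\<in>inputs k. pmf (W x) y)"

lemma pmf_pair_le_sum_inputs:
  "i < k \<Longrightarrow> pmf (W (2 * i + 1)) y + pmf (W (2 * i + 2)) y \<le> (\<Sum>x\<in>inputs k. pmf (W x) y)"
  unfolding sum_inputs
  by (rule member_le_sum[of i "{..<k}" "\<lambda>i. pmf (W (2 * i + 1)) y + pmf (W (2 * i + 2)) y"]) simp_all

lemma info_density_nonneg: "0 \<le> info_density k W i y"
  unfolding info_density_def by (intro divide_nonneg_nonneg sum_nonneg) simp_all

text \<open>Domination by two probability mass functions, which makes the density summable.\<close>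

lemma info_density_le:
  assumes "i < k"
  shows "info_density k W i y \<le> pmf (W (2 * i + 1)) y + pmf (W (2 * i + 2)) y"
proof -
  define a b S where "a = pmf (W (2 * i + 1)) y" and "b = pmf (W (2 * i + 2)) y"
    and "S = (\<Sum>x\<in>inputs k. pmf (W x) y)"
  have ab: "0 \<le> a" "0 \<le> b" "a + b \<le> S"
    using pmf_pair_le_sum_inputs[OF assms] by (auto simp: a_def b_def S_def)
  have "(a - b)\<^sup>2 \<le> (a + b) * (a + b)"
    using ab by (simp add: power2_eq_square algebra_simps)
  also have "\<dots> \<le> (a + b) * S"
    using ab by (intro mult_left_mono) auto
  finally have "(a - b)\<^sup>2 / S \<le> a + b"
    using ab by (cases "S = 0") (auto simp: pos_divide_le_eq)
  then show ?thesis by (simp add: info_density_def a_def b_def S_def)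
qed

lemma has_sum_info_density:
  assumes "i < k"
  shows "(info_density k W i has_sum channel_information_matrix k W $$ (i, i)) UNIV"
proof -
  let ?S = "\<lambda>y. \<Sum>x\<in>inputs k. pmf (W x) y"
  have "(\<lambda>y. pmf (W (2 * i + 1)) y + pmf (W (2 * i + 2)) y) summable_on UNIV"
    using has_sum_pmf by (intro summable_on_add) (auto simp: summable_on_def)
  then have sm: "info_density k W i summable_on UNIV"
    by (rule summable_on_comparison_test) (use info_density_le[OF assms] info_density_nonneg in blast)+
  have "channel_information_matrix k W $$ (i, i) = infsum (info_density k W i) {y. 0 < ?S y}"
    using assms
    by (simp add: channel_information_matrix_def info_density_def[abs_def] power2_eq_square del: One_nat_def add_2_eq_Suc' add_Suc_right)
  also have "\<dots> = infsum (info_density k W i) UNIV"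
  proof (rule infsum_cong_neutral)
    fix y assume "y \<in> UNIV - {y. 0 < ?S y}"
    then have "?S y = 0"
      using sum_nonneg[of "inputs k" "\<lambda>x. pmf (W x) y"] by auto
    then show "info_density k W i y = 0" by (simp add: info_density_def)
  qed auto
  finally show ?thesis using sm by (metis has_sum_infsum)
qed

lemma sum_diag_le_nuclear_norm:
  "(\<Sum>i<k. channel_information_matrix k W $$ (i, i)) \<le> nuclear_norm (channel_information_matrix k W)"
proof (rule trace_le_nuclear_norm)
  show "transpose_mat (channel_information_matrix k W) = channel_information_matrix k W"
    by (rule eq_matI) (auto simp: channel_information_matrix_def mult.commute)
qed (simp add: channel_information_matrix_def)

text \<open>A point of the sign cube is encoded as its set of positive coordinates, so sums over the
  cube run over \<open>Pow {..<k}\<close>.\<close>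

definition spin :: "nat set \<Rightarrow> nat \<Rightarrow> real" where
  "spin z i = (if i \<in> z then 1 else - 1)"

definition flip :: "nat \<Rightarrow> nat set \<Rightarrow> nat set" where
  "flip i z = (if i \<in> z then z - {i} else insert i z)"

lemma spin_flip: "spin (flip i z) j = (if j = i then - spin z i else spin z j)"
  unfolding spin_def flip_def by (cases "i \<in> z"; cases "j = i") simp_all

lemma flip_flip [simp]: "flip i (flip i z) = z"
  unfolding flip_def by (cases "i \<in> z") (simp_all add: insert_absorb)

lemma flip_subset: "i < k \<Longrightarrow> z \<subseteq> {..<k} \<Longrightarrow> flip i z \<subseteq> {..<k}"
  unfolding flip_def by (cases "i \<in> z") auto

lemma bij_betw_flip:
  assumes "i < k"
  shows "bij_betw (flip i) (Pow {..<k}) (Pow {..<k})"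
proof (rule bij_betwI[where g = "flip i"])
  show "flip i \<in> Pow {..<k} \<rightarrow> Pow {..<k}"
    using flip_subset[OF assms] by blast
  then show "flip i \<in> Pow {..<k} \<rightarrow> Pow {..<k}" .
qed (rule flip_flip)+

lemma abs_spin [simp]: "\<bar>spin z i\<bar> = 1"
  by (simp add: spin_def)

definition perturbed :: "nat \<Rightarrow> real \<Rightarrow> nat set \<Rightarrow> nat pmf" where
  "perturbed k \<gamma> z = bind_pmf (pmf_of_set {..<k}) (\<lambda>i.
     bind_pmf (bernoulli_pmf ((1 + \<gamma> * spin z i) / 2)) (\<lambda>b.
       return_pmf (if b then 2 * i + 1 else 2 * i + 2)))"

text \<open>Used twice: for a channel W it is the law of one message, and with
  \<open>return_pmf\<close> for W it yields the point masses of \<open>perturbed\<close>.\<close>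

lemma pmf_bind_perturbed:
  assumes "k \<ge> 1" "0 \<le> \<gamma>" "\<gamma> \<le> 1"
  shows "pmf (bind_pmf (perturbed k \<gamma> z) W) y =
    (\<Sum>i<k. (1 + \<gamma> * spin z i) * pmf (W (2 * i + 1)) y + (1 - \<gamma> * spin z i) * pmf (W (2 * i + 2)) y)
      / (2 * real k)"
proof -
  have b: "0 \<le> (1 + \<gamma> * spin z i) / 2" "(1 + \<gamma> * spin z i) / 2 \<le> 1" for i
    using assms by (auto simp: spin_def)
  have "pmf (bind_pmf (perturbed k \<gamma> z) W) y =
      (\<Sum>i<k. (1 + \<gamma> * spin z i) / 2 * pmf (W (2 * i + 1)) y
        + (1 - (1 + \<gamma> * spin z i) / 2) * pmf (W (2 * i + 2)) y) / real k"
    unfolding perturbed_def bind_assoc_pmf bind_return_pmf pmf_bind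
    using assms b
    by (subst integral_pmf_of_set) (auto simp: lessThan_empty_iff mult.commute intro!: arg_cong2[where f = "(/)"] sum.cong)
  also have "\<dots> = (\<Sum>i<k. ((1 + \<gamma> * spin z i) * pmf (W (2 * i + 1)) y
        + (1 - \<gamma> * spin z i) * pmf (W (2 * i + 2)) y) / 2) / real k"
    by (intro arg_cong2[where f = "(/)"] sum.cong refl) (simp add: field_simps)
  finally show ?thesis by (simp add: sum_divide_distrib[symmetric] field_simps)
qed

lemma pmf_perturbed:
  assumes "k \<ge> 1" "0 \<le> \<gamma>" "\<gamma> \<le> 1" "i < k"
  shows "pmf (perturbed k \<gamma> z) (2 * i + 1) = (1 + \<gamma> * spin z i) / (2 * real k)"
    and "pmf (perturbed k \<gamma> z) (2 * i + 2) = (1 - \<gamma> * spin z i) / (2 * real k)"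
proof -
  have sum_mult_if: "(\<Sum>j<k. f j * (if j = i then 1 else 0)) = f i" for f :: "nat \<Rightarrow> real"
    using assms(4) by (subst sum.remove[of _ i]) auto
  have ind: "indicator {2 * i + 1} (2 * j + 1) = (if j = i then 1 else 0 :: real)"
    "indicator {2 * i + 2} (2 * j + 2) = (if j = i then 1 else 0 :: real)"
    "indicator {2 * i + 1} (2 * j + 2) = (0 :: real)"
    "indicator {2 * i + 2} (2 * j + 1) = (0 :: real)" for j
    by (auto simp: indicator_def) presburger+
  show "pmf (perturbed k \<gamma> z) (2 * i + 1) = (1 + \<gamma> * spin z i) / (2 * real k)"
    using pmf_bind_perturbed[OF assms(1-3), of z return_pmf "2 * i + 1"] assms(4)
    by (simp only: bind_return_pmf' pmf_return ind) (simp add: sum_mult_if)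
  show "pmf (perturbed k \<gamma> z) (2 * i + 2) = (1 - \<gamma> * spin z i) / (2 * real k)"
    using pmf_bind_perturbed[OF assms(1-3), of z return_pmf "2 * i + 2"] assms(4)
    by (simp only: bind_return_pmf' pmf_return ind) (simp add: sum_mult_if)
qed

lemma perturbed_in_dists:
  assumes "k \<ge> 1"
  shows "perturbed k \<gamma> z \<in> dists k"
proof -
  have set: "set_pmf (pmf_of_set {..<k}) = {..<k}"
    using assms by (intro set_pmf_of_set) (auto simp: lessThan_empty_iff)
  have "set_pmf (bind_pmf (pmf_of_set {..<k}) (\<lambda>i. bind_pmf (B i) (\<lambda>b.
      return_pmf (if b then 2 * i + 1 else 2 * i + 2)))) \<subseteq> inputs k" for B
    unfolding set_bind_pmf set_return_pmf set by (auto simp: inputs_def)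
  then show ?thesis
    unfolding dists_def perturbed_def mem_Collect_eq .
qed

lemma pmf_bind_perturbed_diff:
  assumes "k \<ge> 1" "0 \<le> \<gamma>" "\<gamma> \<le> 1" "i < k"
  shows "pmf (bind_pmf (perturbed k \<gamma> z) W) y - pmf (bind_pmf (perturbed k \<gamma> (flip i z)) W) y =
    \<gamma> * spin z i / real k * (pmf (W (2 * i + 1)) y - pmf (W (2 * i + 2)) y)"
proof -
  have "(\<Sum>j<k. (1 + \<gamma> * spin z j) * pmf (W (2 * j + 1)) y + (1 - \<gamma> * spin z j) * pmf (W (2 * j + 2)) y)
    - (\<Sum>j<k. (1 + \<gamma> * spin (flip i z) j) * pmf (W (2 * j + 1)) y + (1 - \<gamma> * spin (flip i z) j) * pmf (W (2 * j + 2)) y)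
    = (\<Sum>j<k. if j = i then 2 * \<gamma> * spin z i * (pmf (W (2 * i + 1)) y - pmf (W (2 * i + 2)) y) else 0)"
    unfolding sum_subtractf[symmetric] by (intro sum.cong refl) (auto simp: spin_flip algebra_simps)
  also have "\<dots> = 2 * \<gamma> * spin z i * (pmf (W (2 * i + 1)) y - pmf (W (2 * i + 2)) y)"
    using assms by simp
  finally show ?thesis
    using assms by (simp add: pmf_bind_perturbed diff_divide_distrib[symmetric])
qed

text \<open>Provides the function g for \<open>nn_integral_tri_mult_pmf_le\<close>. A message has
  probability at least \<open>S / (8 * real k)\<close>, and the squared difference is the density
  times 8 \<gamma>^2 / k times that lower bound.\<close>

lemma pmf_bind_perturbed_diff_sq_le:
  assumes "k \<ge> 1" "0 \<le> \<gamma>" "\<gamma> \<le> 3 / 4" "i < k"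
  shows "(pmf (bind_pmf (perturbed k \<gamma> z) W) y - pmf (bind_pmf (perturbed k \<gamma> (flip i z)) W) y)\<^sup>2
    \<le> (8 * \<gamma>\<^sup>2 / real k * info_density k W i y) * pmf (bind_pmf (perturbed k \<gamma> z) W) y"
proof -
  define S \<Delta> where "S = (\<Sum>x\<in>inputs k. pmf (W x) y)"
    and "\<Delta> = pmf (W (2 * i + 1)) y - pmf (W (2 * i + 2)) y"
  have "S / 4 \<le> (\<Sum>j<k. (1 + \<gamma> * spin z j) * pmf (W (2 * j + 1)) y + (1 - \<gamma> * spin z j) * pmf (W (2 * j + 2)) y)"
    unfolding S_def sum_inputs sum_divide_distrib
  proof (intro sum_mono)
    fix j
    \<comment> \<open>Here \<gamma> \<le> 3/4 enters: no weight falls below 1 - 3/4.\<close>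
    have "1 / 4 \<le> 1 + \<gamma> * spin z j" "1 / 4 \<le> 1 - \<gamma> * spin z j"
      using assms by (auto simp: spin_def)
    then have "1 / 4 * pmf (W (2 * j + 1)) y \<le> (1 + \<gamma> * spin z j) * pmf (W (2 * j + 1)) y"
      "1 / 4 * pmf (W (2 * j + 2)) y \<le> (1 - \<gamma> * spin z j) * pmf (W (2 * j + 2)) y"
      by (simp_all only: mult_right_mono pmf_nonneg)
    then show "(pmf (W (2 * j + 1)) y + pmf (W (2 * j + 2)) y) / 4
      \<le> (1 + \<gamma> * spin z j) * pmf (W (2 * j + 1)) y + (1 - \<gamma> * spin z j) * pmf (W (2 * j + 2)) y"
      by simp
  qed
  then have p: "S / (8 * real k) \<le> pmf (bind_pmf (perturbed k \<gamma> z) W) y"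
    using assms by (simp add: pmf_bind_perturbed field_simps)
  have S: "0 \<le> S" by (simp add: S_def sum_nonneg)
  \<comment> \<open>Where the denominator vanishes so does the numerator, so the default value 0 of
    the quotient is the right one.\<close>
  have "\<Delta> = 0" if "S = 0"
    using pmf_pair_le_sum_inputs[OF assms(4), of W y] that
      pmf_nonneg[of "W (2 * i + 1)" y] pmf_nonneg[of "W (2 * i + 2)" y]
    unfolding S_def \<Delta>_def by linarith
  then have "(\<gamma> * spin z i / real k * \<Delta>)\<^sup>2 = (8 * \<gamma>\<^sup>2 / real k * (\<Delta>\<^sup>2 / S)) * (S / (8 * real k))"
    using assms by (cases "S = 0") (auto simp: spin_def power2_eq_square)
  also have "\<dots> \<le> (8 * \<gamma>\<^sup>2 / real k * (\<Delta>\<^sup>2 / S)) * pmf (bind_pmf (perturbed k \<gamma> z) W) y"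
    using p S by (intro mult_left_mono) auto
  finally show ?thesis
    using assms by (simp add: pmf_bind_perturbed_diff info_density_def S_def \<Delta>_def)
qed

subsection \<open>Transcripts\<close>

primrec transcript :: "('a list \<Rightarrow> 'a pmf) \<Rightarrow> nat \<Rightarrow> 'a list pmf" where
  "transcript V 0 = return_pmf []"
| "transcript V (Suc t) = bind_pmf (transcript V t) (\<lambda>ys. map_pmf (\<lambda>y. ys @ [y]) (V ys))"

text \<open>Each sample feeds a single message, so samples can be drawn lazily: given the history,
  the next message comes from a fresh sample. The protocol becomes a process with history-dependent
  kernels.\<close>

lemma messages_eq_transcript:
  "messages n sel p u = transcript (\<lambda>ys. bind_pmf p (sel ys u)) n"
proof -
  define V where "V ys = bind_pmf p (sel ys u)" for ys
  \<comment> \<open>\<open>F m ys\<close> is the law of the full transcript once ys has been sent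
    and m users remain.\<close>
  define F where "F m ys = bind_pmf (replicate_pmf m p) (\<lambda>xs. messages_from sel u xs ys)" for m ys
  have F0: "F 0 ys = return_pmf ys" for ys
    by (simp add: F_def bind_return_pmf)
  have FSuc: "F (Suc m) ys = bind_pmf (map_pmf (\<lambda>y. ys @ [y]) (V ys)) (F m)" for m ys
  proof -
    have "F (Suc m) ys = bind_pmf p (\<lambda>x. bind_pmf (replicate_pmf m p) (\<lambda>xs.
        bind_pmf (sel ys u x) (\<lambda>y. messages_from sel u xs (ys @ [y]))))"
      by (simp add: F_def bind_assoc_pmf bind_return_pmf)
    \<comment> \<open>The later samples are independent of the current message, so the draws
      commute.\<close>
    also have "\<dots> = bind_pmf p (\<lambda>x. bind_pmf (sel ys u x) (\<lambda>y. F m (ys @ [y])))"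
      unfolding F_def by (subst bind_commute_pmf) (rule refl)
    also have "\<dots> = bind_pmf (map_pmf (\<lambda>y. ys @ [y]) (V ys)) (F m)"
      by (simp add: V_def bind_assoc_pmf bind_map_pmf)
    finally show ?thesis .
  qed
  have "bind_pmf (transcript V t) (F m) = transcript V (t + m)" for t m
  proof (induction m arbitrary: t)
    case 0
    then show ?case by (simp add: F0[abs_def] bind_return_pmf')
  next
    case (Suc m)
    have "bind_pmf (transcript V t) (F (Suc m)) = bind_pmf (transcript V (Suc t)) (F m)"
      by (simp add: FSuc[abs_def] bind_assoc_pmf)
    with Suc[of "Suc t"] show ?case by simp
  qed
  from this[of 0 n] show ?thesis
    by (simp add: bind_return_pmf F_def messages_def V_def[abs_def])
qed

lemma length_transcript: "ys \<in> set_pmf (transcript V t) \<Longrightarrow> length ys = t"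
  by (induction t arbitrary: ys) auto

lemma pmf_transcript_eq_0: "length ys \<noteq> t \<Longrightarrow> pmf (transcript V t) ys = 0"
  using length_transcript by (metis set_pmf_iff)

lemma pmf_transcript_Suc:
  "pmf (transcript V (Suc t)) (ys @ [y]) = pmf (transcript V t) ys * pmf (V ys) y"
proof -
  have "pmf (map_pmf (\<lambda>y. xs @ [y]) (V xs)) (ys @ [y]) = pmf (V ys) y * indicator {ys} xs" for xs
  proof (cases "xs = ys")
    case True
    have "pmf (map_pmf (\<lambda>y. ys @ [y]) (V ys)) ((\<lambda>y. ys @ [y]) y) = pmf (V ys) y"
      by (rule pmf_map_inj') (auto intro: injI)
    with True show ?thesis by simp
  next
    case False
    then have "ys @ [y] \<notin> set_pmf (map_pmf (\<lambda>y. xs @ [y]) (V xs))" by auto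
    with False show ?thesis by (simp add: pmf_eq_0_set_pmf)
  qed
  then show ?thesis
    by (simp add: pmf_bind measure_pmf_single)
qed

text \<open>Separates the last message from the history in sums over all transcripts.\<close>

lemma nn_integral_count_space_snoc:
  fixes f :: "'a list \<Rightarrow> ennreal"
  assumes "f [] = 0"
  shows "(\<integral>\<^sup>+l. f l \<partial>count_space UNIV) =
    (\<integral>\<^sup>+ys. \<integral>\<^sup>+y. f (ys @ [y]) \<partial>count_space UNIV \<partial>count_space UNIV)"
proof -
  have b: "bij_betw (\<lambda>(ys, y). ys @ [y]) (UNIV :: ('a list \<times> 'a) set) (UNIV - {[]})"
  proof (rule bij_betwI[where g = "\<lambda>l. (butlast l, last l)"])
    show "(\<lambda>(ys, y). ys @ [y]) \<in> UNIV \<rightarrow> UNIV - {[]}" by auto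
  qed auto
  have "(\<integral>\<^sup>+l. f l \<partial>count_space UNIV) = (\<integral>\<^sup>+l. f l \<partial>count_space (UNIV - {[]}))"
    using assms by (intro nn_integral_count_space_eq) auto
  also have "\<dots> = (\<integral>\<^sup>+x. f (case x of (ys, y) \<Rightarrow> ys @ [y]) \<partial>count_space UNIV)"
    by (rule nn_integral_bij_count_space[OF b, symmetric])
  also have "\<dots> = (\<integral>\<^sup>+ys. \<integral>\<^sup>+y. f (ys @ [y]) \<partial>count_space UNIV \<partial>count_space UNIV)"
    by (subst nn_integral_fst_count_space[symmetric]) simp
  finally show ?thesis .
qed

text \<open>For each history ys, \<open>nn_integral_tri_mult_pmf_le\<close> applies with the two
  probabilities of ys as weights. The bound \<open>G ys\<close> may vary with ys, which covers
  adaptive choices; the increment is the sum of the expectations of G / 4 under both laws.\<close>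

lemma nn_integral_tri_transcript_Suc_le:
  fixes V V' :: "'a list \<Rightarrow> 'a pmf"
  assumes g: "\<And>ys y. 0 \<le> g ys y" "\<And>ys. (g ys has_sum G ys) UNIV"
    and gp: "\<And>ys y. (pmf (V ys) y - pmf (V' ys) y)\<^sup>2 \<le> g ys y * pmf (V ys) y"
    and gq: "\<And>ys y. (pmf (V ys) y - pmf (V' ys) y)\<^sup>2 \<le> g ys y * pmf (V' ys) y"
  shows "(\<integral>\<^sup>+l. ennreal (tri (pmf (transcript V (Suc t)) l) (pmf (transcript V' (Suc t)) l)) \<partial>count_space UNIV)
    \<le> (\<integral>\<^sup>+ys. ennreal (tri (pmf (transcript V t) ys) (pmf (transcript V' t) ys)) \<partial>count_space UNIV)
      + (\<integral>\<^sup>+ys. ennreal (pmf (transcript V t) ys * (G ys / 4)) \<partial>count_space UNIV)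
      + (\<integral>\<^sup>+ys. ennreal (pmf (transcript V' t) ys * (G ys / 4)) \<partial>count_space UNIV)"
proof -
  have G: "0 \<le> G ys" for ys
    using g by (metis has_sum_nonneg)
  have nil: "pmf (transcript U (Suc t)) [] = 0" for U :: "'a list \<Rightarrow> 'a pmf"
    by (rule pmf_transcript_eq_0) simp
  have "(\<integral>\<^sup>+l. ennreal (tri (pmf (transcript V (Suc t)) l) (pmf (transcript V' (Suc t)) l)) \<partial>count_space UNIV)
    = (\<integral>\<^sup>+ys. \<integral>\<^sup>+y. ennreal (tri (pmf (transcript V t) ys * pmf (V ys) y) (pmf (transcript V' t) ys * pmf (V' ys) y))
        \<partial>count_space UNIV \<partial>count_space UNIV)"
    by (subst nn_integral_count_space_snoc) (simp_all only: nil pmf_transcript_Suc, simp add: tri_def)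
  also have "\<dots> \<le> (\<integral>\<^sup>+ys. ennreal (tri (pmf (transcript V t) ys) (pmf (transcript V' t) ys)
      + (pmf (transcript V t) ys + pmf (transcript V' t) ys) / 4 * G ys) \<partial>count_space UNIV)"
    by (intro nn_integral_mono, rule nn_integral_tri_mult_pmf_le[OF _ _ g gp gq]) simp_all
  also have "\<dots> = (\<integral>\<^sup>+ys. (ennreal (tri (pmf (transcript V t) ys) (pmf (transcript V' t) ys))
      + ennreal (pmf (transcript V t) ys * (G ys / 4))) + ennreal (pmf (transcript V' t) ys * (G ys / 4)) \<partial>count_space UNIV)"
    by (intro nn_integral_cong)
      (simp add: ennreal_plus[symmetric] tri_nonneg G algebra_simps add_divide_distrib del: ennreal_plus)
  finally show ?thesis
    by (simp add: nn_integral_add)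
qed

text \<open>Summing over all \<open>z\<close> and flipped coordinates \<open>i\<close>, the diagonal entries of the information
  matrix add up to its trace, because flipping \<open>i\<close> permutes the cube.\<close>

lemma sum_nn_integral_tri_transcript_le:
  fixes S :: "nat list \<Rightarrow> channel" and k n :: nat and \<gamma> :: real
  defines "T \<equiv> \<lambda>z. transcript (\<lambda>ys. bind_pmf (perturbed k \<gamma> z) (S ys))"
  assumes "k \<ge> 1" "0 \<le> \<gamma>" "\<gamma> \<le> 3 / 4" "0 \<le> r"
    and r: "\<And>ys. length ys < n \<Longrightarrow> nuclear_norm (channel_information_matrix k (S ys)) \<le> r"
    and "t \<le> n"
  shows "(\<Sum>z\<in>Pow {..<k}. \<Sum>i<k. \<integral>\<^sup>+l. ennreal (tri (pmf (T z t) l) (pmf (T (flip i z) t) l)) \<partial>count_space UNIV)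
    \<le> ennreal (real t * (2 ^ k * (4 * \<gamma>\<^sup>2 * r / real k)))"
  using \<open>t \<le> n\<close>
proof (induction t)
  case 0
  then show ?case by (simp add: T_def tri_def)
next
  case (Suc t)
  let ?P = "Pow {..<k}"
  define c where "c = 8 * \<gamma>\<^sup>2 / real k"
  have c: "0 \<le> c" by (simp add: c_def)
  define H where "H i ys = channel_information_matrix k (S ys) $$ (i, i)" for i ys
  have H: "0 \<le> H i ys" if "i < k" for i ys
    unfolding H_def using has_sum_nonneg[OF has_sum_info_density[OF that]] info_density_nonneg by blast
  define I where "I z i = (\<integral>\<^sup>+ys. ennreal (pmf (T z t) ys * (c * H i ys / 4)) \<partial>count_space UNIV)" for z i
  let ?A = "\<lambda>t z i. \<integral>\<^sup>+l. ennreal (tri (pmf (T z t) l) (pmf (T (flip i z) t) l)) \<partial>count_space UNIV"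
  have step: "?A (Suc t) z i \<le> ?A t z i + I z i + I (flip i z) i" if "i < k" for z i
    unfolding T_def I_def
  proof (rule nn_integral_tri_transcript_Suc_le[where g = "\<lambda>ys y. c * info_density k (S ys) i y"])
    fix ys y
    show "0 \<le> c * info_density k (S ys) i y"
      using c info_density_nonneg by simp
    show "((\<lambda>y. c * info_density k (S ys) i y) has_sum c * H i ys) UNIV"
      unfolding H_def by (intro has_sum_cmult_right has_sum_info_density that)
    let ?V = "\<lambda>z. pmf (bind_pmf (perturbed k \<gamma> z) (S ys)) y"
    show "(?V z - ?V (flip i z))\<^sup>2 \<le> c * info_density k (S ys) i y * ?V z"
      unfolding c_def using assms that by (intro pmf_bind_perturbed_diff_sq_le)
    \<comment> \<open>The bound relative to the other law is the same bound at
      \<open>flip i z\<close>, whose flip is z.\<close>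
    have "(?V (flip i z) - ?V (flip i (flip i z)))\<^sup>2 \<le> c * info_density k (S ys) i y * ?V (flip i z)"
      unfolding c_def using assms that by (intro pmf_bind_perturbed_diff_sq_le)
    then show "(?V z - ?V (flip i z))\<^sup>2 \<le> c * info_density k (S ys) i y * ?V (flip i z)"
      by (simp add: power2_commute)
  qed
  have "(\<Sum>z\<in>?P. \<Sum>i<k. ?A (Suc t) z i) \<le> (\<Sum>z\<in>?P. \<Sum>i<k. ?A t z i + I z i + I (flip i z) i)"
    by (intro sum_mono step) simp
  also have "\<dots> = (\<Sum>z\<in>?P. \<Sum>i<k. ?A t z i) + (\<Sum>z\<in>?P. \<Sum>i<k. I z i) + (\<Sum>z\<in>?P. \<Sum>i<k. I (flip i z) i)"
    by (simp add: sum.distrib)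
  also have "(\<Sum>z\<in>?P. \<Sum>i<k. I (flip i z) i) = (\<Sum>z\<in>?P. \<Sum>i<k. I z i)"
  proof -
    have "(\<Sum>z\<in>?P. I (flip i z) i) = (\<Sum>z\<in>?P. I z i)" if "i < k" for i
      by (rule sum.reindex_bij_betw[OF bij_betw_flip[OF that]])
    then show ?thesis by (subst (1 2) sum.swap) simp
  qed
  also have "(\<Sum>z\<in>?P. \<Sum>i<k. I z i) \<le> (\<Sum>z\<in>?P. ennreal (c * r / 4))"
  proof (rule sum_mono)
    fix z
    have "(\<Sum>i<k. I z i) = (\<integral>\<^sup>+ys. (\<Sum>i<k. ennreal (pmf (T z t) ys * (c * H i ys / 4))) \<partial>count_space UNIV)"
      unfolding I_def by (rule nn_integral_sum[symmetric]) simp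
    also have "\<dots> \<le> (\<integral>\<^sup>+ys. ennreal (pmf (T z t) ys * (c * r / 4)) \<partial>count_space UNIV)"
    proof (rule nn_integral_mono)
      fix ys
      have "(\<Sum>i<k. ennreal (pmf (T z t) ys * (c * H i ys / 4))) = ennreal (\<Sum>i<k. pmf (T z t) ys * (c * H i ys / 4))"
        using c H by (intro sum_ennreal) auto
      also have "(\<Sum>i<k. pmf (T z t) ys * (c * H i ys / 4)) = pmf (T z t) ys * (c * (\<Sum>i<k. H i ys) / 4)"
        by (simp add: sum_distrib_left sum_divide_distrib)
      also have "ennreal \<dots> \<le> ennreal (pmf (T z t) ys * (c * r / 4))"
      \<comment> \<open>The nuclear norm bound applies to histories of length t < n; lists of any
        other length have mass 0.\<close>
      proof (cases "length ys = t")
        case True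
        with Suc.prems have "(\<Sum>i<k. H i ys) \<le> r"
          unfolding H_def using r sum_diag_le_nuclear_norm by (meson Suc_le_lessD order_trans)
        then show ?thesis
          using c by (intro ennreal_leI mult_left_mono divide_right_mono) auto
      qed (simp add: T_def pmf_transcript_eq_0)
      finally show "(\<Sum>i<k. ennreal (pmf (T z t) ys * (c * H i ys / 4))) \<le> ennreal (pmf (T z t) ys * (c * r / 4))" .
    qed
    also have "\<dots> = ennreal (c * r / 4)"
    proof -
      have "(\<integral>\<^sup>+ys. ennreal (pmf (T z t) ys * w) \<partial>count_space UNIV) = ennreal w" if "0 \<le> w" for w
        using that by (simp add: ennreal_mult nn_integral_multc nn_integral_pmf)
      from this[of "c * r / 4"] show ?thesis using c \<open>0 \<le> r\<close> by fastforce
    qed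
    finally show "(\<Sum>i<k. I z i) \<le> ennreal (c * r / 4)" .
  qed
  also have "(\<Sum>z\<in>?P. ennreal (c * r / 4)) = ennreal (2 ^ k * (c * r / 4))"
    using c \<open>0 \<le> r\<close> by (subst sum_ennreal) (auto simp: card_Pow)
  finally have "(\<Sum>z\<in>?P. \<Sum>i<k. ?A (Suc t) z i) \<le>
      ennreal (real t * (2 ^ k * (4 * \<gamma>\<^sup>2 * r / real k))) + ennreal (2 ^ k * (c * r / 4)) + ennreal (2 ^ k * (c * r / 4))"
    using Suc by (meson Suc_leD add_mono order_trans order_refl)
  \<comment> \<open>The two increments agree, and 2 c r / 4 = 4 \<gamma>^2 r / k.\<close>
  also have "\<dots> = ennreal (real (Suc t) * (2 ^ k * (4 * \<gamma>\<^sup>2 * r / real k)))"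
    using c \<open>0 \<le> r\<close> by (simp add: c_def ennreal_plus[symmetric] algebra_simps add_divide_distrib del: ennreal_plus)
  finally show ?case .
qed

text \<open>The left side is at most the sum of |P - Q|, to which \<open>abs_diff_le_tri\<close>
  applies; P + Q has total mass 2.\<close>

lemma expectation_pmf_diff_le:
  fixes P Q :: "'a pmf" and f :: "'a \<Rightarrow> real"
  assumes f: "\<And>x. \<bar>f x\<bar> \<le> 1" and "0 < \<tau>"
  shows "measure_pmf.expectation P f - measure_pmf.expectation Q f
    \<le> 2 * \<tau> + enn2real (\<integral>\<^sup>+x. ennreal (tri (pmf P x) (pmf Q x)) \<partial>count_space UNIV) / (4 * \<tau>)"
proof -
  let ?C = "count_space (UNIV :: 'a set)"
  have i: "integrable ?C (pmf R)" for R :: "'a pmf"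
    by (rule integrable_pmf)
  have E: "measure_pmf.expectation R f = (\<integral>x. pmf R x * f x \<partial>?C)" for R
    unfolding measure_pmf_eq_density by (subst integral_density) auto
  have iE: "integrable ?C (\<lambda>x. pmf R x * f x)" for R
    by (rule Bochner_Integration.integrable_bound[OF i[of R]])
      (auto simp: abs_mult intro!: mult_right_le_one_le f)
  have it: "integrable ?C (\<lambda>x. tri (pmf P x) (pmf Q x))"
    by (rule Bochner_Integration.integrable_bound[OF Bochner_Integration.integrable_add[OF i[of P] i[of Q]]])
      (auto simp: tri_nonneg tri_le_add)
  have one: "(\<integral>x. pmf R x \<partial>?C) = 1" for R :: "'a pmf"
    by (subst integral_eq_nn_integral) (auto simp: nn_integral_pmf)
  have "measure_pmf.expectation P f - measure_pmf.expectation Q f = (\<integral>x. pmf P x * f x - pmf Q x * f x \<partial>?C)"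
    unfolding E using iE by simp
  also have "\<dots> \<le> (\<integral>x. \<tau> * (pmf P x + pmf Q x) + tri (pmf P x) (pmf Q x) / (4 * \<tau>) \<partial>?C)"
  proof (rule integral_mono)
    fix x
    have "pmf P x * f x - pmf Q x * f x \<le> \<bar>pmf P x - pmf Q x\<bar> * \<bar>f x\<bar>"
      unfolding left_diff_distrib[symmetric] abs_mult[symmetric] by simp
    also have "\<dots> \<le> \<bar>pmf P x - pmf Q x\<bar>"
      using f by (simp add: mult_right_le_one_le)
    also have "\<dots> \<le> \<tau> * (pmf P x + pmf Q x) + tri (pmf P x) (pmf Q x) / (4 * \<tau>)"
      using assms by (intro abs_diff_le_tri) auto
    finally show "pmf P x * f x - pmf Q x * f x \<le> \<tau> * (pmf P x + pmf Q x) + tri (pmf P x) (pmf Q x) / (4 * \<tau>)" .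
  qed (use i it iE in auto)
  also have "\<dots> = 2 * \<tau> + (\<integral>x. tri (pmf P x) (pmf Q x) \<partial>?C) / (4 * \<tau>)"
    using i it by (simp add: one)
  also have "(\<integral>x. tri (pmf P x) (pmf Q x) \<partial>?C) = enn2real (\<integral>\<^sup>+x. ennreal (tri (pmf P x) (pmf Q x)) \<partial>?C)"
    by (rule integral_eq_nn_integral) (auto simp: tri_nonneg)
  finally show ?thesis .
qed

text \<open>Pairing z with \<open>flip i z\<close> writes the correlation of \<open>d i\<close> with
  the i-th spin as half a difference of expectations under laws that differ in that spin only, and
  the total discrimination bounds the sum of these.\<close>

lemma sum_correlation_le:
  fixes S :: "nat list \<Rightarrow> channel" and k n :: nat and \<gamma> :: real
  defines "T \<equiv> \<lambda>z. transcript (\<lambda>ys. bind_pmf (perturbed k \<gamma> z) (S ys))"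
  assumes k: "k \<ge> 1" "0 \<le> \<gamma>" "\<gamma> \<le> 3 / 4" "0 \<le> r"
    and r: "\<And>ys. length ys < n \<Longrightarrow> nuclear_norm (channel_information_matrix k (S ys)) \<le> r"
    and d: "\<And>i ys. \<bar>d i ys\<bar> \<le> (1 :: real)"
  shows "(\<Sum>z\<in>Pow {..<k}. \<Sum>i<k. spin z i * measure_pmf.expectation (T z n) (d i))
    \<le> 2 ^ k * (real k / 10 + 5 * real n * \<gamma>\<^sup>2 * r / real k)"
proof -
  let ?P = "Pow {..<k}"
  define E where "E z i = measure_pmf.expectation (T z n) (d i)" for z i
  define D where "D z i = (\<integral>\<^sup>+l. ennreal (tri (pmf (T z n) l) (pmf (T (flip i z) n) l)) \<partial>count_space UNIV)" for z i
  have A: "(\<Sum>z\<in>?P. \<Sum>i<k. D z i) \<le> ennreal (real n * (2 ^ k * (4 * \<gamma>\<^sup>2 * r / real k)))"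
    unfolding D_def T_def by (rule sum_nn_integral_tri_transcript_le[OF k r order_refl])
  \<comment> \<open>Finiteness matters because \<open>enn2real\<close> sends infinity to 0.\<close>
  have fin: "D z i < \<infinity>" if "z \<in> ?P" "i < k" for z i
  proof -
    have "D z i \<le> (\<Sum>i<k. D z i)"
      using that by (intro member_le_sum) auto
    also have "\<dots> \<le> (\<Sum>z\<in>?P. \<Sum>i<k. D z i)"
      using that by (intro member_le_sum[of z ?P "\<lambda>z. \<Sum>i<k. D z i"]) auto
    also note A
    also have "ennreal (real n * (2 ^ k * (4 * \<gamma>\<^sup>2 * r / real k))) < \<infinity>" by simp
    finally show ?thesis .
  qed
  have R: "(\<Sum>z\<in>?P. \<Sum>i<k. enn2real (D z i)) \<le> real n * (2 ^ k * (4 * \<gamma>\<^sup>2 * r / real k))"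
  proof -
    have "ennreal (\<Sum>z\<in>?P. \<Sum>i<k. enn2real (D z i)) = (\<Sum>z\<in>?P. \<Sum>i<k. ennreal (enn2real (D z i)))"
      by (subst sum_ennreal[symmetric]) (auto intro!: sum_nonneg sum.cong simp: sum_ennreal)
    also have "\<dots> = (\<Sum>z\<in>?P. \<Sum>i<k. D z i)"
      using fin by (intro sum.cong refl ennreal_enn2real) auto
    finally have "ennreal (\<Sum>z\<in>?P. \<Sum>i<k. enn2real (D z i))
        \<le> ennreal (real n * (2 ^ k * (4 * \<gamma>\<^sup>2 * r / real k)))"
      using A by (simp only:)
    then show ?thesis
      by (rule ennreal_le_iff[THEN iffD1, rotated]) (use k in auto)
  qed
  \<comment> \<open>Averages the sum with its copy reindexed by the flip, under which the spin
    changes sign.\<close>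
  have half: "(\<Sum>z\<in>?P. spin z i * E z i) = (\<Sum>z\<in>?P. (spin z i * E z i - spin z i * E (flip i z) i) / 2)"
    if "i < k" for i
  proof -
    have "(\<Sum>z\<in>?P. spin (flip i z) i * E (flip i z) i) = (\<Sum>z\<in>?P. spin z i * E z i)"
      by (rule sum.reindex_bij_betw[OF bij_betw_flip[OF that]])
    then have "(\<Sum>z\<in>?P. - (spin z i * E (flip i z) i)) = (\<Sum>z\<in>?P. spin z i * E z i)"
      by (simp add: spin_flip)
    then show ?thesis
      by (simp add: sum_divide_distrib[symmetric] sum_subtractf sum_negf)
  qed
  have "(\<Sum>z\<in>?P. \<Sum>i<k. spin z i * E z i) = (\<Sum>i<k. \<Sum>z\<in>?P. spin z i * E z i)"
    by (rule sum.swap)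
  also have "\<dots> = (\<Sum>i<k. \<Sum>z\<in>?P. (spin z i * E z i - spin z i * E (flip i z) i) / 2)"
    by (intro sum.cong refl half) simp
  also have "\<dots> \<le> (\<Sum>i<k. \<Sum>z\<in>?P. 1 / 10 + 5 / 4 * enn2real (D z i))"
  proof (intro sum_mono)
    fix i z
    \<comment> \<open>With \<tau> = 1/10 the constant part after halving is 1/10 per coordinate,
      below the 1/3 that a successful estimate forces.\<close>
    have "measure_pmf.expectation (T z n) (\<lambda>l. spin z i * d i l)
        - measure_pmf.expectation (T (flip i z) n) (\<lambda>l. spin z i * d i l)
      \<le> 2 * (1 / 10) + enn2real (D z i) / (4 * (1 / 10))"
      unfolding D_def using d by (intro expectation_pmf_diff_le) (auto simp: abs_mult)
    then show "(spin z i * E z i - spin z i * E (flip i z) i) / 2 \<le> 1 / 10 + 5 / 4 * enn2real (D z i)"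
      by (simp add: E_def)
  qed
  also have "\<dots> = 2 ^ k * (real k / 10) + 5 / 4 * (\<Sum>z\<in>?P. \<Sum>i<k. enn2real (D z i))"
    by (subst (2) sum.swap) (simp add: sum.distrib sum_distrib_left card_Pow)
  also have "\<dots> \<le> 2 ^ k * (real k / 10) + 5 / 4 * (real n * (2 ^ k * (4 * \<gamma>\<^sup>2 * r / real k)))"
    by (intro add_left_mono mult_left_mono R) simp
  also have "\<dots> = 2 ^ k * (real k / 10 + 5 * real n * \<gamma>\<^sup>2 * r / real k)"
    using k by (simp add: field_simps)
  finally show ?thesis by (simp add: E_def)
qed

subsection \<open>Recovering the perturbation from an estimate\<close>

lemma finite_inputs [simp]: "finite (inputs k)"
  by (simp add: inputs_def)

lemma prob_diff_le_dTV:
  "S \<subseteq> inputs k \<Longrightarrow> measure_pmf.prob p S - measure_pmf.prob q S \<le> dTV k p q"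
  unfolding dTV_def by (rule cSUP_upper) (auto intro!: bdd_above_finite)

text \<open>Within a pair, |e - e'| = 2 max(e, e') - (e + e') for the excesses e, e' of p over q.
  The sums e + e' cancel in total, and the larger members form a set whose excess mass is at most
  \<open>dTV\<close>.\<close>

lemma sum_abs_diff_le_dTV:
  assumes "p \<in> dists k" "q \<in> dists k"
  shows "(\<Sum>i<k. \<bar>(pmf p (2 * i + 1) - pmf p (2 * i + 2)) - (pmf q (2 * i + 1) - pmf q (2 * i + 2))\<bar>)
    \<le> 2 * dTV k p q"
proof -
  define e where "e x = pmf p x - pmf q x" for x
  define c where "c i = (if e (2 * i + 2) \<le> e (2 * i + 1) then 2 * i + 1 else 2 * i + 2)" for i
  have c: "c i \<in> {2 * i + 1, 2 * i + 2}" for i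
    by (simp add: c_def)
  have inj: "inj_on c {..<k}"
  proof (rule inj_onI)
    fix i j assume "c i = c j"
    then show "i = j" using c[of i] c[of j] by auto
  qed
  have sub: "c ` {..<k} \<subseteq> inputs k"
    by (auto simp: c_def inputs_def)
  have "(\<Sum>x\<in>inputs k. e x) = (\<Sum>x\<in>inputs k. pmf p x) - (\<Sum>x\<in>inputs k. pmf q x)"
    by (simp add: e_def sum_subtractf)
  also have "\<dots> = 0"
    using assms by (simp add: dists_def sum_pmf_eq_1)
  finally have e0: "(\<Sum>i<k. e (2 * i + 1) + e (2 * i + 2)) = 0"
    by (simp only: sum_inputs)
  have "(\<Sum>i<k. e (c i)) = measure_pmf.prob p (c ` {..<k}) - measure_pmf.prob q (c ` {..<k})"
    using inj by (simp add: measure_measure_pmf_finite sum.reindex e_def sum_subtractf)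
  also have "\<dots> \<le> dTV k p q"
    using sub by (rule prob_diff_le_dTV)
  finally have le: "(\<Sum>i<k. e (c i)) \<le> dTV k p q" .
  have "(\<Sum>i<k. \<bar>(pmf p (2 * i + 1) - pmf p (2 * i + 2)) - (pmf q (2 * i + 1) - pmf q (2 * i + 2))\<bar>)
    = (\<Sum>i<k. 2 * e (c i) - (e (2 * i + 1) + e (2 * i + 2)))"
    by (intro sum.cong refl) (auto simp: c_def e_def)
  also have "\<dots> = 2 * (\<Sum>i<k. e (c i))"
    using e0 by (simp only: sum_subtractf sum_distrib_left diff_0_right)
  finally show ?thesis using le by simp
qed

text \<open>Rounding an estimate to a point of the cube would only bound the Hamming distance by \<open>2k/3\<close>,
  no better than guessing; the clipped value keeps a correlation with \<open>z\<close> bounded away from 0.\<close>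

definition decode :: "nat \<Rightarrow> real \<Rightarrow> nat pmf \<Rightarrow> nat \<Rightarrow> real" where
  "decode k \<gamma> p i = max (- 1) (min 1 (real k / \<gamma> * (pmf p (2 * i + 1) - pmf p (2 * i + 2))))"

lemma abs_decode_le_1: "\<bar>decode k \<gamma> p i\<bar> \<le> 1"
  by (auto simp: decode_def max_def min_def)

text \<open>Clipping to [-1, 1] does not increase the distance to a spin, and
  \<open>sum_abs_diff_le_dTV\<close> bounds the total distance before clipping by (k / \<gamma>) (2
  \<gamma> / 3) = 2k/3. This leaves k - 2k/3.\<close>

lemma sum_spin_decode_ge:
  assumes "k \<ge> 1" "0 < \<gamma>" "\<gamma> \<le> 1" "p \<in> dists k"
    and "dTV k p (perturbed k \<gamma> z) \<le> \<gamma> / 3"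
  shows "real k / 3 \<le> (\<Sum>i<k. spin z i * decode k \<gamma> p i)"
proof -
  let ?q = "perturbed k \<gamma> z"
  define x where "x i = real k / \<gamma> * (pmf p (2 * i + 1) - pmf p (2 * i + 2))" for i
  have "1 - spin z i * decode k \<gamma> p i \<le> \<bar>x i - spin z i\<bar>" for i
    unfolding decode_def x_def[symmetric] by (auto simp: spin_def max_def min_def)
  then have "(\<Sum>i<k. 1 - spin z i * decode k \<gamma> p i) \<le> (\<Sum>i<k. \<bar>x i - spin z i\<bar>)"
    by (intro sum_mono)
  also have "\<dots> = (\<Sum>i<k. real k / \<gamma> * \<bar>(pmf p (2 * i + 1) - pmf p (2 * i + 2)) - (pmf ?q (2 * i + 1) - pmf ?q (2 * i + 2))\<bar>)"
  proof (intro sum.cong refl)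
    fix i assume "i \<in> {..<k}"
    then have "pmf ?q (2 * i + 1) - pmf ?q (2 * i + 2) = \<gamma> * spin z i / real k"
      using assms by (simp only: pmf_perturbed lessThan_iff) (simp add: field_simps)
    then have "x i - spin z i = real k / \<gamma> * ((pmf p (2 * i + 1) - pmf p (2 * i + 2)) - (pmf ?q (2 * i + 1) - pmf ?q (2 * i + 2)))"
      using assms by (simp add: x_def right_diff_distrib)
    then show "\<bar>x i - spin z i\<bar> = real k / \<gamma> * \<bar>(pmf p (2 * i + 1) - pmf p (2 * i + 2)) - (pmf ?q (2 * i + 1) - pmf ?q (2 * i + 2))\<bar>"
      using assms by (simp only: abs_mult) simp
  qed
  also have "\<dots> = real k / \<gamma> * (\<Sum>i<k. \<bar>(pmf p (2 * i + 1) - pmf p (2 * i + 2)) - (pmf ?q (2 * i + 1) - pmf ?q (2 * i + 2))\<bar>)"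
    by (simp only: sum_distrib_left)
  also have "\<dots> \<le> real k / \<gamma> * (2 * (\<gamma> / 3))"
    using assms sum_abs_diff_le_dTV[OF assms(4) perturbed_in_dists[OF assms(1)], of \<gamma> z]
    by (intro mult_left_mono) auto
  also have "\<dots> = 2 * real k / 3" using assms by simp
  finally show ?thesis by (simp add: sum_subtractf)
qed

text \<open>On success the decoded correlation is at least k/3, on failure at least -k, a loss of
  4k/3. Comparison with \<open>sum_correlation_le\<close> leaves k/3 - k/10 = 7k/30, and \<gamma> =
  3 \<epsilon> turns 5 \<gamma>^2 into 45 \<epsilon>^2.\<close>

lemma sum_failure_ge:
  fixes S :: "nat list \<Rightarrow> channel" and k n :: nat and \<epsilon> :: real
  defines "T \<equiv> \<lambda>z. transcript (\<lambda>ys. bind_pmf (perturbed k (3 * \<epsilon>) z) (S ys))"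
  assumes k: "k \<ge> 1" "0 < \<epsilon>" "\<epsilon> \<le> 1 / 4" "0 \<le> r"
    and r: "\<And>ys. length ys < n \<Longrightarrow> nuclear_norm (channel_information_matrix k (S ys)) \<le> r"
    and ph: "\<And>ys. length ys = n \<Longrightarrow> ph ys \<in> dists k"
  shows "2 ^ k * (7 / 30 * real k - 45 * real n * \<epsilon>\<^sup>2 * r / real k)
    \<le> 4 / 3 * real k * (\<Sum>z\<in>Pow {..<k}. measure_pmf.prob (T z n) {ys. \<epsilon> < dTV k (ph ys) (perturbed k (3 * \<epsilon>) z)})"
proof -
  let ?P = "Pow {..<k}"
  define B where "B z = {ys. \<epsilon> < dTV k (ph ys) (perturbed k (3 * \<epsilon>) z)}" for z
  define d where "d i ys = decode k (3 * \<epsilon>) (ph ys) i" for i ys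
  have d: "\<bar>d i ys\<bar> \<le> 1" for i ys
    by (simp add: d_def abs_decode_le_1)
  have int: "integrable (measure_pmf (T z n)) (d i)" for z i
    by (rule measure_pmf.integrable_const_bound[where B = 1]) (auto simp: d)
  have intB: "integrable (measure_pmf (T z n)) (indicator (B z) :: _ \<Rightarrow> real)" for z
    by (rule measure_pmf.integrable_const_bound[where B = 1]) (auto simp: indicator_def)
  have one: "real k / 3 - 4 / 3 * real k * measure_pmf.prob (T z n) (B z)
      \<le> (\<Sum>i<k. spin z i * measure_pmf.expectation (T z n) (d i))" for z
  proof -
    have "real k / 3 - 4 / 3 * real k * measure_pmf.prob (T z n) (B z)
      = measure_pmf.expectation (T z n) (\<lambda>ys. real k / 3 - 4 / 3 * real k * indicator (B z) ys)"
      by (subst Bochner_Integration.integral_diff) (simp_all add: intB del: times_divide_eq_left)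
    also have "\<dots> \<le> measure_pmf.expectation (T z n) (\<lambda>ys. \<Sum>i<k. spin z i * d i ys)"
    proof (rule integral_mono_AE)
      show "AE ys in measure_pmf (T z n). real k / 3 - 4 / 3 * real k * indicator (B z) ys
          \<le> (\<Sum>i<k. spin z i * d i ys)"
      proof (rule AE_pmfI)
        fix ys assume "ys \<in> set_pmf (T z n)"
        then have "length ys = n" unfolding T_def by (rule length_transcript)
        show "real k / 3 - 4 / 3 * real k * indicator (B z) ys \<le> (\<Sum>i<k. spin z i * d i ys)"
        proof (cases "ys \<in> B z")
          case True
          have "- 1 \<le> spin z i * d i ys" for i
            using d[of i ys] by (auto simp: spin_def)
          then have "(\<Sum>i<k. - 1) \<le> (\<Sum>i<k. spin z i * d i ys)"
            by (intro sum_mono)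
          with True show ?thesis by simp
        next
          case False
          then have "real k / 3 \<le> (\<Sum>i<k. spin z i * d i ys)"
            unfolding d_def using k ph[OF \<open>length ys = n\<close>]
            by (intro sum_spin_decode_ge) (auto simp: B_def)
          with False show ?thesis by simp
        qed
      qed
    qed (use int intB in auto)
    also have "\<dots> = (\<Sum>i<k. spin z i * measure_pmf.expectation (T z n) (d i))"
      using int by simp
    finally show ?thesis .
  qed
  have "(\<Sum>z\<in>?P. real k / 3 - 4 / 3 * real k * measure_pmf.prob (T z n) (B z))
      \<le> (\<Sum>z\<in>?P. \<Sum>i<k. spin z i * measure_pmf.expectation (T z n) (d i))"
    by (intro sum_mono one)
  also have "\<dots> \<le> 2 ^ k * (real k / 10 + 5 * real n * (3 * \<epsilon>)\<^sup>2 * r / real k)"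
    unfolding T_def by (rule sum_correlation_le[OF _ _ _ _ r d]) (use k in auto)
  finally have "2 ^ k * (real k / 3) - 4 / 3 * real k * (\<Sum>z\<in>?P. measure_pmf.prob (T z n) (B z))
      \<le> 2 ^ k * (real k / 10 + 45 * real n * \<epsilon>\<^sup>2 * r / real k)"
    by (simp add: sum_subtractf card_Pow sum_distrib_left power_mult_distrib mult.assoc)
  moreover have "a * (7 / 30 * c - y) \<le> x" if "a * (c / 3) - x \<le> a * (c / 10 + y)" for a c x y :: real
    using that by (simp add: algebra_simps)
  ultimately show ?thesis
    unfolding B_def by blast
qed

subsection \<open>Measurability in the public randomness\<close>

text \<open>As p lives on \<open>inputs k\<close>, each message probability is a finite combination
  of functions that \<open>protocol\<close> makes measurable.\<close>

lemma measurable_pmf_transcript: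
  assumes "protocol k n \<W> M sel" "p \<in> dists k" "t \<le> n"
  shows "(\<lambda>u. pmf (transcript (\<lambda>ys. bind_pmf p (sel ys u)) t) ys) \<in> borel_measurable M"
  using \<open>t \<le> n\<close>
proof (induction t arbitrary: ys)
  case (Suc t)
  show ?case
  proof (cases "length ys = Suc t")
    case True
    then obtain xs y where ys: "ys = xs @ [y]" "length xs = t"
      by (metis length_Suc_conv_rev)
    have "pmf (bind_pmf p W) y = (\<Sum>x\<in>inputs k. pmf (W x) y * pmf p x)" for W
      unfolding pmf_bind using assms(2)
      by (intro integral_measure_pmf_real) (auto simp: dists_def)
    moreover have "(\<lambda>u. pmf (sel xs u x) y) \<in> borel_measurable M" if "x \<in> inputs k" for x
      using assms(1) that ys Suc.prems by (simp add: protocol_def)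
    ultimately have "(\<lambda>u. pmf (bind_pmf p (sel xs u)) y) \<in> borel_measurable M"
      by simp
    moreover have "(\<lambda>u. pmf (transcript (\<lambda>ys. bind_pmf p (sel ys u)) t) xs) \<in> borel_measurable M"
      using Suc by simp
    ultimately show ?thesis
      unfolding ys pmf_transcript_Suc by (intro borel_measurable_times)
  next
    case False
    then have "(\<lambda>u. pmf (transcript (\<lambda>ys. bind_pmf p (sel ys u)) (Suc t)) ys) = (\<lambda>u. 0)"
      by (intro ext pmf_transcript_eq_0)
    then show ?thesis by simp
  qed
qed simp

text \<open>Lets the sum over the cube be exchanged with the integral over u. The probability is a
  series over countably many transcripts, and for each of them failure is a finite union over S,
  since \<open>dTV\<close> is a maximum over finitely many sets.\<close>

lemma measurable_failure:
  assumes prot: "protocol k n \<W> M sel" and p: "p \<in> dists k"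
    and ph: "\<And>ys x. length ys = n \<Longrightarrow> x \<in> inputs k \<Longrightarrow> (\<lambda>u. pmf (phat ys u) x) \<in> borel_measurable M"
  shows "(\<lambda>u. emeasure (measure_pmf (messages n sel p u)) {ys. dTV k (phat ys u) p > \<epsilon>}) \<in> borel_measurable M"
proof -
  let ?T = "\<lambda>u. transcript (\<lambda>ys. bind_pmf p (sel ys u)) n"
  let ?f = "from_nat_into (UNIV :: nat list set)"
  let ?B = "\<lambda>u. {ys. dTV k (phat ys u) p > \<epsilon>}"
  have b: "bij_betw ?f UNIV UNIV"
    by (rule bij_betw_from_nat_into) (auto simp: infinite_UNIV_listI)
  have eq: "emeasure (measure_pmf (messages n sel p u)) (?B u)
      = (\<Sum>j. ennreal (pmf (?T u) (?f j)) * indicator (?B u) (?f j))" for u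
  proof -
    have "emeasure (measure_pmf (messages n sel p u)) (?B u) = (\<integral>\<^sup>+ys. indicator (?B u) ys \<partial>measure_pmf (?T u))"
      unfolding messages_eq_transcript by simp
    also have "\<dots> = (\<integral>\<^sup>+ys. ennreal (pmf (?T u) ys) * indicator (?B u) ys \<partial>count_space UNIV)"
      by (rule nn_integral_measure_pmf)
    also have "\<dots> = (\<integral>\<^sup>+j. ennreal (pmf (?T u) (?f j)) * indicator (?B u) (?f j) \<partial>count_space UNIV)"
      by (rule nn_integral_bij_count_space[OF b, symmetric])
    finally show ?thesis by (simp add: nn_integral_count_space_nat)
  qed
  have summand: "(\<lambda>u. ennreal (pmf (?T u) ys) * indicator (?B u) ys) \<in> borel_measurable M" for ys
  \<comment> \<open>Measurability of \<open>phat\<close> is given for lists of length n; all others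
    have mass 0.\<close>
  proof (cases "length ys = n")
    case True
    have prob: "(\<lambda>u. measure_pmf.prob (phat ys u) S) \<in> borel_measurable M" if "S \<subseteq> inputs k" for S
    proof -
      have "finite S" using that finite_inputs by (rule finite_subset)
      then show ?thesis
        using that True ph by (auto simp: measure_measure_pmf_finite intro!: borel_measurable_sum)
    qed
    have "\<epsilon> < dTV k q p \<longleftrightarrow> (\<exists>S\<in>Pow (inputs k). \<epsilon> < measure_pmf.prob q S - measure_pmf.prob p S)" for q
      unfolding dTV_def by (rule less_cSUP_iff) (auto intro!: bdd_above_finite)
    then have "(\<lambda>u. indicator (?B u) ys :: ennreal) = (\<lambda>u. if \<exists>S\<in>Pow (inputs k).
        \<epsilon> < measure_pmf.prob (phat ys u) S - measure_pmf.prob p S then 1 else 0)"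
      by (auto simp: indicator_def)
    also have "\<dots> \<in> borel_measurable M"
    proof (rule measurable_If)
      have "Measurable.pred M (\<lambda>u. \<exists>S\<in>Pow (inputs k). \<epsilon> < measure_pmf.prob (phat ys u) S - measure_pmf.prob p S)"
        by (intro pred_intros_finite borel_measurable_pred_less borel_measurable_diff prob) auto
      then show "{u \<in> space M. \<exists>S\<in>Pow (inputs k). \<epsilon> < measure_pmf.prob (phat ys u) S - measure_pmf.prob p S} \<in> sets M"
        by (simp only: pred_def)
    qed simp_all
    finally show ?thesis
      using measurable_pmf_transcript[OF prot p order_refl] by (intro borel_measurable_times_ennreal measurable_compose[OF _ measurable_ennreal])
  next
    case False
    then show ?thesis by (simp add: pmf_transcript_eq_0)
  qed
  show ?thesis
    unfolding eq by (intro borel_measurable_suminf_order summand)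
qed

subsection \<open>Lower bound\<close>

text \<open>For each fixed u, \<open>sum_failure_ge\<close> bounds the total failure over the cube
  below by \<open>K\<close>. Integration over u keeps this bound, while each of the 2^k integrated
  terms is at most 1/100.\<close>

lemma estimator_lower_bound:
  assumes k: "k \<ge> 1" and \<epsilon>: "0 < \<epsilon>" "\<epsilon> \<le> 1 / 4"
    and est: "estimator k n \<epsilon> \<W> M sel phat"
    and r: "0 \<le> r" "family_norm k \<W> \<le> ennreal r"
  shows "1 / 300 * (real k)\<^sup>2 \<le> real n * (\<epsilon>\<^sup>2 * r)"
proof -
  let ?P = "Pow {..<k}"
  let ?p = "perturbed k (3 * \<epsilon>)"
  define X where "X = 45 * real n * \<epsilon>\<^sup>2 * r / real k"
  \<comment> \<open>Possibly negative; \<open>ennreal K\<close> is then 0 and the comparison below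
    stays valid.\<close>
  define K where "K = 2 ^ k * (7 / 30 * real k - X) / (4 / 3 * real k)"
  have prot: "protocol k n \<W> M sel" using est by (simp add: estimator_def)
  then interpret M: prob_space M by (simp add: protocol_def)
  define F where "F z u = emeasure (measure_pmf (messages n sel (?p z) u)) {ys. dTV k (phat ys u) (?p z) > \<epsilon>}" for z u
  have meas: "F z \<in> borel_measurable M" for z
    unfolding F_def using est
    by (intro measurable_failure[OF prot perturbed_in_dists[OF k]]) (auto simp: estimator_def)
  have F_le: "(\<integral>\<^sup>+u. F z u \<partial>M) \<le> ennreal (1 / 100)" for z
  proof -
    have "(\<integral>\<^sup>+u. F z u \<partial>M) = failure_prob k n \<epsilon> M sel phat (?p z)"
      by (simp add: failure_prob_def F_def)
    also have "\<dots> \<le> (SUP p\<in>dists k. failure_prob k n \<epsilon> M sel phat p)"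
      by (rule SUP_upper[OF perturbed_in_dists[OF k]])
    also have "\<dots> \<le> ennreal (1 / 100)"
      using est by (simp add: estimator_def)
    finally show ?thesis .
  qed
  have ge: "ennreal K \<le> (\<Sum>z\<in>?P. F z u)" if u: "u \<in> space M" for u
  proof -
    let ?fail = "\<lambda>z. measure_pmf.prob (messages n sel (?p z) u) {ys. dTV k (phat ys u) (?p z) > \<epsilon>}"
    have nn: "nuclear_norm (channel_information_matrix k (sel ys u)) \<le> r" if "length ys < n" for ys
    proof -
      have "sel ys u \<in> \<W>" using prot that u by (simp add: protocol_def)
      then have "ennreal (nuclear_norm (channel_information_matrix k (sel ys u))) \<le> family_norm k \<W>"
        unfolding family_norm_def by (rule SUP_upper)
      also note r(2)
      finally show ?thesis using r(1) by (simp add: ennreal_le_iff)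
    qed
    have dst: "phat ys u \<in> dists k" if "length ys = n" for ys
      using est that u by (simp add: estimator_def)
    have "2 ^ k * (7 / 30 * real k - X) \<le> 4 / 3 * real k * (\<Sum>z\<in>?P. ?fail z)"
      unfolding X_def messages_eq_transcript
      by (rule sum_failure_ge[OF k \<epsilon> r(1) nn dst])
    then have "K \<le> (\<Sum>z\<in>?P. ?fail z)"
      using k by (simp add: K_def pos_divide_le_eq mult.commute)
    then have "ennreal K \<le> (\<Sum>z\<in>?P. ennreal (?fail z))"
      by (simp add: sum_ennreal ennreal_leI)
    then show ?thesis
      by (simp add: F_def measure_pmf.emeasure_eq_measure)
  qed
  have "ennreal K = (\<integral>\<^sup>+u. ennreal K \<partial>M)"
    by (simp add: M.emeasure_space_1)
  also have "\<dots> \<le> (\<integral>\<^sup>+u. (\<Sum>z\<in>?P. F z u) \<partial>M)"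
    by (intro nn_integral_mono ge)
  also have "\<dots> = (\<Sum>z\<in>?P. \<integral>\<^sup>+u. F z u \<partial>M)"
    using meas by (intro nn_integral_sum) auto
  also have "\<dots> \<le> (\<Sum>z\<in>?P. ennreal (1 / 100))"
    by (intro sum_mono F_le)
  also have "\<dots> = ennreal (2 ^ k / 100)"
    by (subst sum_ennreal) (auto simp: card_Pow)
  finally have "K \<le> 2 ^ k / 100"
    by (simp add: ennreal_le_iff)
  then have "2 ^ k * (7 / 30 * real k - X) \<le> 2 ^ k * (4 / 300 * real k)"
    using k by (simp add: K_def pos_divide_le_eq)
  then have "7 / 30 * real k - X \<le> 4 / 300 * real k"
    by (rule mult_left_le_imp_le) simp
  \<comment> \<open>7/30 - 4/300 = 11/50, and 11/50 divided by 45 exceeds the claimed 1/300.\<close>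
  then have "11 / 50 * real k \<le> X" by simp
  then have "11 / 50 * real k * real k \<le> 45 * (real n * (\<epsilon>\<^sup>2 * r))"
    using k by (simp add: X_def pos_le_divide_eq mult.assoc)
  then have "11 / 50 * (real k)\<^sup>2 \<le> 45 * (real n * (\<epsilon>\<^sup>2 * r))"
    by (simp add: power2_eq_square)
  with zero_le_power2[of "real k"] show ?thesis by linarith
qed

theorem theorem2:
  shows "\<exists>c::real. c > 0 \<and>
    (\<forall>(k::nat) (\<epsilon>::real) (\<W>::channel set). k \<ge> 1 \<longrightarrow> 0 < \<epsilon> \<longrightarrow> \<epsilon> \<le> 1 / 4 \<longrightarrow>
      ennreal_of_enat (sample_complexity k \<epsilon> \<W>) \<ge>
        ennreal c * (ennreal ((real k)\<^sup>2) / (ennreal (\<epsilon>\<^sup>2) * family_norm k \<W>)))"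
proof (intro exI[of _ "1 / 300"] conjI allI impI)
  fix k :: nat and \<epsilon> :: real and \<W> :: "channel set"
  assume k: "k \<ge> 1" and \<epsilon>: "0 < \<epsilon>" "\<epsilon> \<le> 1 / 4"
  let ?N = "{n. \<exists>M sel phat. estimator k n \<epsilon> \<W> M sel phat}"
  let ?bound = "ennreal (1 / 300) * (ennreal ((real k)\<^sup>2) / (ennreal (\<epsilon>\<^sup>2) * family_norm k \<W>))"
  show "?bound \<le> ennreal_of_enat (sample_complexity k \<epsilon> \<W>)"
  proof (cases "?N = {}")
    case True
    then have "sample_complexity k \<epsilon> \<W> = \<infinity>"
      by (simp add: sample_complexity_def top_enat_def)
    then show ?thesis by simp
  next
    case False
    \<comment> \<open>A nonempty set of naturals attains its infimum, so some estimator uses exactly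
      this many users.\<close>
    then obtain m where "enat m \<in> enat ` ?N" by blast
    then have "(LEAST x. x \<in> enat ` ?N) \<in> enat ` ?N" by (rule LeastI)
    with False have "sample_complexity k \<epsilon> \<W> \<in> enat ` ?N"
      unfolding sample_complexity_def Inf_enat_def by (simp only: image_is_empty if_False)
    then obtain n M sel phat where n: "sample_complexity k \<epsilon> \<W> = enat n"
      and est: "estimator k n \<epsilon> \<W> M sel phat" by auto
    show ?thesis
    proof (cases "family_norm k \<W>")
      case (real r)
      from estimator_lower_bound[OF k \<epsilon> est, of r] real
      have le: "1 / 300 * (real k)\<^sup>2 \<le> real n * (\<epsilon>\<^sup>2 * r)" by simp
      \<comment> \<open>Positivity of the left side excludes a zero norm, so the extended quotient
        is an ordinary one.\<close>
      moreover have "0 < 1 / 300 * (real k)\<^sup>2" using k by simp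
      ultimately have "0 < real n * (\<epsilon>\<^sup>2 * r)" by linarith
      then have pos: "0 < \<epsilon>\<^sup>2 * r"
        by (simp add: zero_less_mult_iff)
      have "?bound = ennreal (1 / 300 * ((real k)\<^sup>2 / (\<epsilon>\<^sup>2 * r)))"
        using pos real by (simp add: divide_ennreal ennreal_mult[symmetric])
      also have "\<dots> \<le> ennreal (real n)"
        using le pos by (intro ennreal_leI) (simp add: pos_divide_le_eq)
      finally show ?thesis by (simp add: n ennreal_of_nat_eq_real_of_nat)
    next
      case top
      \<comment> \<open>An infinite norm makes the claimed bound 0.\<close>
      have "ennreal (\<epsilon>\<^sup>2) * \<top> = \<top>" using \<epsilon> by (simp add: ennreal_mult_top)
      then show ?thesis by (simp add: top)
    qed
  qed
qed simp

end
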